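(* Let $E$ be a finite set, let $J\subseteq\{\pm1,0\}^E$, and put $L:=\,\uparrow\! J\cap\{\pm1\}^E$. The following statements are equivalent: (i) $[J]$ is weakly convex; (ii) $\uparrow\! J$ is sign-convex; (iii) $\uparrow\! J$ is $0$-convex; (iv) $J$ is $0$-convex; (v) $\uparrow\! J$ is an isometric subset of the grid graph $G(\{\pm1,0\}^E)$; (vi) $L$ is ample, $[J]=|L|$, and $\uparrow\! J=\mathrm{Baryc}(L)$.
   Context: $E$ is a finite set; $\{\pm1\}^E\subset\{\pm1,0\}^E\subset\mathbb R^E$ are sets of maps on $E$. The $\ell_1$-metric on $\mathbb R^E$ is $d(r',r'')=\sum_{e\in E}|r'(e)-r''(e)|$. Order: on $\{-1,0,+1\}$ let $\prec$ be the (reflexive) partial order with $0\prec-1$, $0\prec+1$ and $-1,+1$ incomparable; $\prec$ also denotes the product order on $\{\pm1,0\}^E$, i.e. $t_1\prec t_2$ iff $t_1(x)\in\{0,t_2(x)\}$ for all $x\in E$. The upward closure of $J\subseteq\{\pm1,0\}^E$ is $\uparrow\! J=\{t'\in\{\pm1,0\}^E: t\prec t'\text{ for some }t\in J\}$. Grid graph: $G(\{\pm1,0\}^E)$ is the undirected Hasse diagram of $(\{\pm1,0\}^E,\prec)$: $t,t'$ are adjacent iff they differ in exactly one coordinate and one of them is $0$ there (equivalently $d(t,t')=1$); its graph distance is $d$. A subset $U$ is isometric if any two $t,t'\in U$ can be joined by a path of $d(t,t')$ edges, all of whose vertices lie in $U$. Ampleness: a set $A\subseteq E$ is shattered by $L\subseteq\{\pm1\}^E$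 if $\{s|_A: s\in L\}=\{\pm1\}^A$. $L$ is ample if $\#L$ equals the number of subsets $A\subseteq E$ shattered by $L$. Cube complexes: $H(E)=[-1,+1]^E$. A face of $H(E)$ is a set $\{r\in H(E): r|_{E-A}=s_0\}$ with $A\subseteq E$, $s_0\in\{\pm1\}^{E-A}$; its barycenter is the map equal to $0$ on $A$ and to $s_0$ on $E-A$. For $t\in\{\pm1,0\}^E$, $F(t)$ is the smallest face of $H(E)$ containing $t$ (the face with barycenter $t$). $[J]:=\bigcup_{t\in J}F(t)$. $|L|$ is the union of all faces $F$ of $H(E)$ with $F\cap\{\pm1\}^E\subseteq L$, and $\mathrm{Baryc}(L)$ is the set of barycenters of all these faces. Weakly convex: $K\subseteq\mathbb R^E$ is weakly convex if $(K,d)$ is complete and for any two distinct $r',r''\in K$ there is $r\in K$, $r\ne r',r''$, with $d(r',r'')=d(r',r)+d(r,r'')$. Sign-convex: $K\subseteq\mathbb R^E$ is sign-convex if for any two distinct $r',r''\in K$ and every $e\in E$ with $r'(e)r''(e)<0$ there is $r\in K$ with $r(e)=0$ and $\mathrm{sign}(r(f))\in\{\mathrm{sign}(r'(f)),\mathrm{sign}(r''(f))\}$ for all $f\in E$ with $r'(f)r''(f)\ge0$. $0$-convex: $K\subseteq\mathbb R^E$ is $0$-convex if for any $r',r''\in K$ and every $e\in E$ with $r'(e)r''(e)<0$ there is $r\in K$ with $r(e)=0$ and $\mathrm{sign}(r(f))\in\{0,\mathrm{sign}(r'(f)),\mathrm{sign}(r''(f))\}$ for all $f\in E\setminus\{e\}$.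 *)

theory Defs
  imports "HOL-Analysis.Analysis"
begin

(* The space \<real>^E is modelled by the maps 'a \<Rightarrow> real that are extensional on E,
   i.e. undefined outside of E, so that two such maps are equal iff they agree
   on E; E may be empty. The restriction of r to A is restrict r A. *)

definition real_maps :: "'a set \<Rightarrow> ('a \<Rightarrow> real) set" where
  "real_maps E = (E \<rightarrow>\<^sub>E UNIV)"

definition sign_maps :: "'a set \<Rightarrow> ('a \<Rightarrow> real) set" where
  "sign_maps E = (E \<rightarrow>\<^sub>E {-1, 1})"

definition sign0_maps :: "'a set \<Rightarrow> ('a \<Rightarrow> real) set" where
  "sign0_maps E = (E \<rightarrow>\<^sub>E {-1, 0, 1})"

definition l1_dist :: "'a set \<Rightarrow> ('a \<Rightarrow> real) \<Rightarrow> ('a \<Rightarrow> real) \<Rightarrow> real" where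
  "l1_dist E r' r'' = (\<Sum>e\<in>E. \<bar>r' e - r'' e\<bar>)"

definition sign_le :: "'a set \<Rightarrow> ('a \<Rightarrow> real) \<Rightarrow> ('a \<Rightarrow> real) \<Rightarrow> bool" where
  "sign_le E t1 t2 \<longleftrightarrow> (\<forall>x\<in>E. t1 x \<in> {0, t2 x})"

definition up_closure :: "'a set \<Rightarrow> ('a \<Rightarrow> real) set \<Rightarrow> ('a \<Rightarrow> real) set" where
  "up_closure E J = {t' \<in> sign0_maps E. \<exists>t\<in>J. sign_le E t t'}"

definition grid_adj :: "'a set \<Rightarrow> ('a \<Rightarrow> real) \<Rightarrow> ('a \<Rightarrow> real) \<Rightarrow> bool" where
  "grid_adj E t t' \<longleftrightarrow> t \<in> sign0_maps E \<and> t' \<in> sign0_maps E \<and>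
     (\<exists>x\<in>E. t x \<noteq> t' x \<and> (t x = 0 \<or> t' x = 0) \<and> (\<forall>y\<in>E - {x}. t y = t' y))"

(* p lists the vertices of a path; it has length p - 1 edges. *)
definition grid_isometric :: "'a set \<Rightarrow> ('a \<Rightarrow> real) set \<Rightarrow> bool" where
  "grid_isometric E U \<longleftrightarrow> (\<forall>t\<in>U. \<forall>t'\<in>U. \<exists>p. p \<noteq> [] \<and> hd p = t \<and> last p = t' \<and>
     distinct p \<and> set p \<subseteq> U \<and> successively (grid_adj E) p \<and>
     real (length p - 1) = l1_dist E t t')"

definition shattered_by :: "('a \<Rightarrow> real) set \<Rightarrow> 'a set \<Rightarrow> bool" where
  "shattered_by L A \<longleftrightarrow> (\<lambda>s. restrict s A) ` L = sign_maps A"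

definition ample :: "'a set \<Rightarrow> ('a \<Rightarrow> real) set \<Rightarrow> bool" where
  "ample E L \<longleftrightarrow> card L = card {A. A \<subseteq> E \<and> shattered_by L A}"

definition solid_cube :: "'a set \<Rightarrow> ('a \<Rightarrow> real) set" where
  "solid_cube E = (E \<rightarrow>\<^sub>E {-1..1})"

definition cube_face :: "'a set \<Rightarrow> 'a set \<Rightarrow> ('a \<Rightarrow> real) \<Rightarrow> ('a \<Rightarrow> real) set" where
  "cube_face E A s = {r \<in> solid_cube E. restrict r (E - A) = s}"

definition cube_faces :: "'a set \<Rightarrow> ('a \<Rightarrow> real) set set" where
  "cube_faces E = {cube_face E A s |A s. A \<subseteq> E \<and> s \<in> sign_maps (E - A)}"

definition face_barycenter :: "'a set \<Rightarrow> 'a set \<Rightarrow> ('a \<Rightarrow> real) \<Rightarrow> ('a \<Rightarrow> real)" where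
  "face_barycenter E A s = (\<lambda>x\<in>E. if x \<in> A then 0 else s x)"

(* LEAST refers to set inclusion; well-definedness is smallest_face_eq below. *)
definition smallest_face :: "'a set \<Rightarrow> ('a \<Rightarrow> real) \<Rightarrow> ('a \<Rightarrow> real) set" where
  "smallest_face E t = (LEAST F. F \<in> cube_faces E \<and> t \<in> F)"

definition face_union :: "'a set \<Rightarrow> ('a \<Rightarrow> real) set \<Rightarrow> ('a \<Rightarrow> real) set" where
  "face_union E J = (\<Union>t\<in>J. smallest_face E t)"

definition cube_complex :: "'a set \<Rightarrow> ('a \<Rightarrow> real) set \<Rightarrow> ('a \<Rightarrow> real) set" where
  "cube_complex E L = \<Union>{F \<in> cube_faces E. F \<inter> sign_maps E \<subseteq> L}"

definition Baryc :: "'a set \<Rightarrow> ('a \<Rightarrow> real) set \<Rightarrow> ('a \<Rightarrow> real) set" where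
  "Baryc E L = {face_barycenter E A s |A s.
     A \<subseteq> E \<and> s \<in> sign_maps (E - A) \<and> cube_face E A s \<inter> sign_maps E \<subseteq> L}"

definition weakly_convex :: "'a set \<Rightarrow> ('a \<Rightarrow> real) set \<Rightarrow> bool" where
  "weakly_convex E K \<longleftrightarrow> Metric_space.mcomplete K (l1_dist E) \<and>
     (\<forall>r'\<in>K. \<forall>r''\<in>K. r' \<noteq> r'' \<longrightarrow>
        (\<exists>r\<in>K. r \<noteq> r' \<and> r \<noteq> r'' \<and> l1_dist E r' r'' = l1_dist E r' r + l1_dist E r r''))"

definition sign_convex :: "'a set \<Rightarrow> ('a \<Rightarrow> real) set \<Rightarrow> bool" where
  "sign_convex E K \<longleftrightarrow> (\<forall>r'\<in>K. \<forall>r''\<in>K. r' \<noteq> r'' \<longrightarrow>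
     (\<forall>e\<in>E. r' e * r'' e < 0 \<longrightarrow>
        (\<exists>r\<in>K. r e = 0 \<and>
           (\<forall>f\<in>E. r' f * r'' f \<ge> 0 \<longrightarrow> sgn (r f) \<in> {sgn (r' f), sgn (r'' f)}))))"

definition zero_convex :: "'a set \<Rightarrow> ('a \<Rightarrow> real) set \<Rightarrow> bool" where
  "zero_convex E K \<longleftrightarrow> (\<forall>r'\<in>K. \<forall>r''\<in>K. \<forall>e\<in>E. r' e * r'' e < 0 \<longrightarrow>
     (\<exists>r\<in>K. r e = 0 \<and> (\<forall>f\<in>E - {e}. sgn (r f) \<in> {0, sgn (r' f), sgn (r'' f)})))"

lemma Metric_space_l1_dist:
  assumes "finite E" and "K \<subseteq> real_maps E"
  shows "Metric_space K (l1_dist E)"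
proof
  fix x y z
  show "0 \<le> l1_dist E x y" by (simp add: l1_dist_def sum_nonneg)
  show "l1_dist E x y = l1_dist E y x" by (simp add: l1_dist_def abs_minus_commute)
  show "l1_dist E x z \<le> l1_dist E x y + l1_dist E y z"
    unfolding l1_dist_def sum.distrib[symmetric] by (rule sum_mono) simp
  assume "x \<in> K" "y \<in> K"
  hence xy: "x \<in> E \<rightarrow>\<^sub>E UNIV" "y \<in> E \<rightarrow>\<^sub>E UNIV" using assms(2) by (auto simp: real_maps_def)
  have "l1_dist E x y = 0 \<longleftrightarrow> (\<forall>e\<in>E. x e = y e)"
    unfolding l1_dist_def using assms(1) by (subst sum_nonneg_eq_0_iff) auto
  also have "\<dots> \<longleftrightarrow> x = y" using PiE_ext[OF xy] by auto
  finally show "l1_dist E x y = 0 \<longleftrightarrow> x = y" .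
qed

lemma smallest_face_eq:
  assumes t: "t \<in> sign0_maps E"
  defines "A \<equiv> {x \<in> E. t x = 0}"
  shows "smallest_face E t = cube_face E A (restrict t (E - A))"
    and "smallest_face E t \<in> cube_faces E"
    and "face_barycenter E A (restrict t (E - A)) = t"
proof -
  let ?s = "restrict t (E - A)"
  have s: "?s \<in> sign_maps (E - A)"
    using t by (fastforce simp: sign_maps_def sign0_maps_def A_def)
  have face: "cube_face E A ?s \<in> cube_faces E"
    using s by (auto simp: cube_faces_def A_def)
  show eq: "smallest_face E t = cube_face E A ?s"
    unfolding smallest_face_def
  proof (rule Least_equality)
    have "t \<in> solid_cube E"
      using t unfolding solid_cube_def sign0_maps_def PiE_iff by force
    thus "cube_face E A ?s \<in> cube_faces E \<and> t \<in> cube_face E A ?s"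
      using face by (simp add: cube_face_def)
  next
    fix F assume F: "F \<in> cube_faces E \<and> t \<in> F"
    then obtain B u where B: "B \<subseteq> E" "u \<in> sign_maps (E - B)" "F = cube_face E B u"
      by (auto simp: cube_faces_def)
    hence u: "restrict t (E - B) = u" using F by (simp add: cube_face_def)
    have sub: "E - B \<subseteq> E - A"
    proof
      fix x assume x: "x \<in> E - B"
      hence "u x \<in> {-1, 1}" using B(2) unfolding sign_maps_def by (rule PiE_mem[rotated])
      moreover have "u x = t x" using u x by auto
      ultimately show "x \<in> E - A" using x by (auto simp: A_def)
    qed
    show "cube_face E A ?s \<subseteq> F"
    proof
      fix r assume r: "r \<in> cube_face E A ?s"
      hence "r x = t x" if "x \<in> E - A" for x
        using that unfolding cube_face_def by (metis (mono_tags, lifting) mem_Collect_eq restrict_apply')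
      hence "restrict r (E - B) = restrict t (E - B)" using sub by (intro restrict_ext) blast
      hence "restrict r (E - B) = u" using u by simp
      thus "r \<in> F" using r B(3) by (simp add: cube_face_def)
    qed
  qed
  show "smallest_face E t \<in> cube_faces E" using eq face by simp
  show "face_barycenter E A ?s = t"
    using t by (auto simp: face_barycenter_def sign0_maps_def A_def PiE_iff extensional_def)
qed

lemma grid_adj_iff_l1_dist:
  assumes "finite E" "t \<in> sign0_maps E" "t' \<in> sign0_maps E"
  shows "grid_adj E t t' \<longleftrightarrow> l1_dist E t t' = 1"
proof
  assume "grid_adj E t t'"
  then obtain x where x: "x \<in> E" "t x \<noteq> t' x" "t x = 0 \<or> t' x = 0" "\<forall>y\<in>E - {x}. t y = t' y"
    by (auto simp: grid_adj_def)
  have "l1_dist E t t' = \<bar>t x - t' x\<bar> + (\<Sum>e\<in>E - {x}. \<bar>t e - t' e\<bar>)"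
    unfolding l1_dist_def using assms(1) x(1) by (rule sum.remove)
  also have "\<dots> = \<bar>t x - t' x\<bar>" using x(4) by simp
  also have "\<dots> = 1"
  proof -
    have "t x \<in> {-1, 0, 1}" "t' x \<in> {-1, 0, 1}"
      using assms(2,3) x(1) by (auto simp: sign0_maps_def PiE_iff)
    thus ?thesis using x(2,3) by auto
  qed
  finally show "l1_dist E t t' = 1" .
next
  assume d: "l1_dist E t t' = 1"
  have v: "t e \<in> {-1, 0, 1}" "t' e \<in> {-1, 0, 1}" if "e \<in> E" for e
    using assms(2,3) that by (auto simp: sign0_maps_def PiE_iff)
  have ge: "\<bar>t e - t' e\<bar> \<ge> 1" if "e \<in> E" "t e \<noteq> t' e" for e
    using v[OF that(1)] that(2) by auto
  obtain x where x: "x \<in> E" "t x \<noteq> t' x"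
  proof (rule ccontr)
    assume "\<not> thesis"
    hence "\<forall>e\<in>E. t e = t' e" using that by blast
    thus False using d by (simp add: l1_dist_def)
  qed
  have sum: "\<bar>t x - t' x\<bar> + (\<Sum>e\<in>E - {x}. \<bar>t e - t' e\<bar>) = 1"
    using d sum.remove[OF assms(1) x(1), of "\<lambda>e. \<bar>t e - t' e\<bar>"] by (simp add: l1_dist_def)
  have "(\<Sum>e\<in>E - {x}. \<bar>t e - t' e\<bar>) \<ge> 0" by (simp add: sum_nonneg)
  hence one: "\<bar>t x - t' x\<bar> = 1" and zero: "(\<Sum>e\<in>E - {x}. \<bar>t e - t' e\<bar>) = 0"
    using sum ge[OF x] by linarith+
  have "\<forall>y\<in>E - {x}. t y = t' y"
    using zero assms(1) by (subst (asm) sum_nonneg_eq_0_iff) auto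
  moreover have "t x = 0 \<or> t' x = 0" using one v[OF x(1)] by auto
  ultimately show "grid_adj E t t'" using x assms by (auto simp: grid_adj_def)
qed

end

theory Submission
  imports Defs
begin

text \<open>
  Let U be the upward closure of J and L its set of sign vectors. A point x of the cube lies
  in [J] iff the vector obtained by rounding its coordinates of absolute value less than 1 to 0
  lies in U. Rounding turns a point of [J] between two vertices of U into a vertex of U between
  them, and conversely two points of [J] can be moved towards each other, inside a face or through
  a point of U supplied by sign-convexity; so weak convexity of [J], sign-convexity of U and the
  isometry of U in the grid all reduce to the existence of intermediate points.

  For ampleness, split L along a coordinate e into its halves. A set shattered by both halves is
  still shattered after e is added, so the number of sets shattered by L is at least the sum of
  the numbers for the halves, while the cardinalities of the halves add up to that of L. Hence
  ampleness passes to halves, and a set shattered by an ample L and not containing e is shattered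
  by one of the halves. Fixing coordinates one at a time, every shattered set becomes the set of
  free coordinates of a cube contained in L, and this gives 0-convexity of the barycenters.
  Conversely, 0-convexity merges, one coordinate at a time, elements of U that differ in sign into
  a cube, so every shattered set carries a cube, and the two counts agree by induction over halves.
\<close>

text \<open>The arguments use only closure under going up. Barycenter sets, and the members of an
  up-set with a fixed nonzero value in one coordinate, share this property, so inductions can leave
  the given \<open>J\<close>.\<close>

definition up_set :: "'a set \<Rightarrow> ('a \<Rightarrow> real) set \<Rightarrow> bool" where
  "up_set E U \<longleftrightarrow> U \<subseteq> sign0_maps E \<and> (\<forall>t\<in>U. \<forall>t'\<in>sign0_maps E. sign_le E t t' \<longrightarrow> t' \<in> U)"

text \<open>The composition of sign vectors from oriented matroid theory, \<open>t\<close> taking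
  precedence over \<open>s\<close>.\<close>

definition fill :: "'a set \<Rightarrow> ('a \<Rightarrow> real) \<Rightarrow> ('a \<Rightarrow> real) \<Rightarrow> ('a \<Rightarrow> real)" where
  "fill E t s = (\<lambda>f\<in>E. if t f = 0 then s f else t f)"

text \<open>For \<open>x\<close> in the solid cube this is the barycenter of the smallest face
  containing \<open>x\<close>.\<close>

definition round_sign :: "'a set \<Rightarrow> ('a \<Rightarrow> real) \<Rightarrow> ('a \<Rightarrow> real)" where
  "round_sign E x = (\<lambda>f\<in>E. if \<bar>x f\<bar> = 1 then x f else 0)"

text \<open>Menger convexity for grid points; pairs at distance 1 are exempt since no third grid
  point lies between them. It mediates between weak convexity, sign-convexity and isometry.\<close>

definition grid_menger :: "'a set \<Rightarrow> ('a \<Rightarrow> real) set \<Rightarrow> bool" where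
  "grid_menger E U \<longleftrightarrow> (\<forall>t\<in>U. \<forall>t'\<in>U. l1_dist E t t' > 1 \<longrightarrow>
     (\<exists>r\<in>U. r \<noteq> t \<and> r \<noteq> t' \<and> l1_dist E t t' = l1_dist E t r + l1_dist E r t'))"

subsection \<open>Sign maps and the order\<close>

lemma sign0_mapsD: "t \<in> sign0_maps E \<Longrightarrow> e \<in> E \<Longrightarrow> t e = -1 \<or> t e = 0 \<or> t e = 1"
  by (auto simp: sign0_maps_def PiE_iff)

lemma sign_mapsD: "t \<in> sign_maps E \<Longrightarrow> e \<in> E \<Longrightarrow> t e = -1 \<or> t e = 1"
  by (auto simp: sign_maps_def PiE_iff)

lemma sign_maps_subset: "sign_maps E \<subseteq> sign0_maps E"
  by (auto simp: sign_maps_def sign0_maps_def PiE_iff)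

lemma sign0_maps_eqI:
  "s \<in> sign0_maps E \<Longrightarrow> t \<in> sign0_maps E \<Longrightarrow> (\<And>e. e \<in> E \<Longrightarrow> s e = t e) \<Longrightarrow> s = t"
  unfolding sign0_maps_def by (rule PiE_ext)

lemma sign_maps_eqI:
  "s \<in> sign_maps E \<Longrightarrow> t \<in> sign_maps E \<Longrightarrow> (\<And>e. e \<in> E \<Longrightarrow> s e = t e) \<Longrightarrow> s = t"
  unfolding sign_maps_def by (rule PiE_ext)

lemma restrict_in_sign0_maps:
  "(\<And>e. e \<in> E \<Longrightarrow> g e \<in> {-1, 0, 1}) \<Longrightarrow> restrict g E \<in> sign0_maps E"
  by (auto simp: sign0_maps_def PiE_iff)

lemma fun_upd_in_sign0_maps:
  "t \<in> sign0_maps E \<Longrightarrow> e \<in> E \<Longrightarrow> v \<in> {-1, 0, 1} \<Longrightarrow> t(e := v) \<in> sign0_maps E"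
  by (auto simp: sign0_maps_def PiE_iff extensional_def)

lemma finite_sign_maps: "finite E \<Longrightarrow> finite (sign_maps E)"
  unfolding sign_maps_def by (rule finite_PiE) auto

lemma fill_in_sign0_maps:
  "t \<in> sign0_maps E \<Longrightarrow> s \<in> sign0_maps E \<Longrightarrow> fill E t s \<in> sign0_maps E"
  unfolding fill_def by (rule restrict_in_sign0_maps) (auto dest: sign0_mapsD)

lemma up_setD: "up_set E U \<Longrightarrow> t \<in> U \<Longrightarrow> t' \<in> sign0_maps E \<Longrightarrow> sign_le E t t' \<Longrightarrow> t' \<in> U"
  by (auto simp: up_set_def)

lemma up_set_sign0: "up_set E U \<Longrightarrow> t \<in> U \<Longrightarrow> t \<in> sign0_maps E"
  by (auto simp: up_set_def)

lemma up_set_fill: "up_set E U \<Longrightarrow> t \<in> U \<Longrightarrow> s \<in> sign0_maps E \<Longrightarrow> fill E t s \<in> U"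
  by (rule up_setD[of E U t]) (auto intro: fill_in_sign0_maps up_set_sign0, auto simp: sign_le_def fill_def)

lemma up_set_fun_upd:
  "up_set E U \<Longrightarrow> t \<in> U \<Longrightarrow> e \<in> E \<Longrightarrow> t e = 0 \<Longrightarrow> v \<in> {-1, 0, 1} \<Longrightarrow> t(e := v) \<in> U"
  by (rule up_setD[of E U t]) (auto intro: fun_upd_in_sign0_maps up_set_sign0 simp: sign_le_def)

lemma up_set_up_closure: "up_set E (up_closure E J)"
  unfolding up_set_def
proof (intro conjI ballI impI)
  fix t t' assume "t \<in> up_closure E J" and t': "t' \<in> sign0_maps E" "sign_le E t t'"
  then obtain u where u: "u \<in> J" "sign_le E u t" by (auto simp: up_closure_def)
  then have "sign_le E u t'" using t'(2) by (fastforce simp: sign_le_def)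
  then show "t' \<in> up_closure E J" using u t' by (auto simp: up_closure_def)
qed (auto simp: up_closure_def)

lemma subset_up_closure: "J \<subseteq> sign0_maps E \<Longrightarrow> J \<subseteq> up_closure E J"
  by (auto simp: up_closure_def sign_le_def)

subsection \<open>Zero-convexity and sign-convexity\<close>

lemma sgn_sign0: "t \<in> sign0_maps E \<Longrightarrow> e \<in> E \<Longrightarrow> sgn (t e) = t e"
  by (auto dest!: sign0_mapsD)

lemma zero_convexD:
  assumes "zero_convex E U" "U \<subseteq> sign0_maps E" "s \<in> U" "t \<in> U" "e \<in> E" "s e * t e < 0"
  shows "\<exists>r\<in>U. r e = 0 \<and> (\<forall>f\<in>E. r f \<in> {0, s f, t f})"
proof -
  obtain r where r: "r \<in> U" "r e = 0" "\<forall>f\<in>E - {e}. sgn (r f) \<in> {0, sgn (s f), sgn (t f)}"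
    using assms unfolding zero_convex_def by blast
  have "r f \<in> {0, s f, t f}" if "f \<in> E" for f
  proof (cases "f = e")
    case False
    then have "sgn (r f) \<in> {0, sgn (s f), sgn (t f)}" using r(3) that by blast
    then show ?thesis using sgn_sign0[OF _ that] assms(2,3,4) r(1) by (simp add: subset_iff)
  qed (simp add: r(2))
  then show ?thesis using r by blast
qed

lemma zero_convexI:
  assumes "U \<subseteq> sign0_maps E"
    and "\<And>s t e. s \<in> U \<Longrightarrow> t \<in> U \<Longrightarrow> e \<in> E \<Longrightarrow> s e * t e < 0 \<Longrightarrow>
      \<exists>r\<in>U. r e = 0 \<and> (\<forall>f\<in>E. r f \<in> {0, s f, t f})"
  shows "zero_convex E U"
  unfolding zero_convex_def
proof (intro ballI impI)
  fix s t e assume st: "s \<in> U" "t \<in> U" "e \<in> E" "s e * t e < 0"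
  then obtain r where r: "r \<in> U" "r e = 0" "\<forall>f\<in>E. r f \<in> {0, s f, t f}"
    using assms(2) by blast
  have "sgn (r f) \<in> {0, sgn (s f), sgn (t f)}" if "f \<in> E - {e}" for f
    using r(3) that by fastforce
  then show "\<exists>r\<in>U. r e = 0 \<and> (\<forall>f\<in>E - {e}. sgn (r f) \<in> {0, sgn (s f), sgn (t f)})"
    using r by blast
qed

text \<open>A member of \<open>J\<close> below a witness has at most additional zeros and is again a
  witness. Conversely, \<open>s\<close> and \<open>t\<close> are replaced by members of
  \<open>J\<close> below them: either one of these vanishes at \<open>e\<close> already, or both
  keep the opposite values there.\<close>

lemma zero_convex_up_closure_iff:
  assumes J: "J \<subseteq> sign0_maps E"
  shows "zero_convex E (up_closure E J) \<longleftrightarrow> zero_convex E J"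
proof
  have U: "up_closure E J \<subseteq> sign0_maps E" by (auto simp: up_closure_def)
  {
    assume Z: "zero_convex E (up_closure E J)"
    show "zero_convex E J"
    proof (rule zero_convexI[OF J])
      fix s t e assume st: "s \<in> J" "t \<in> J" "e \<in> E" "s e * t e < 0"
      have su: "s \<in> up_closure E J" "t \<in> up_closure E J" using st subset_up_closure[OF J] by auto
      obtain r where r: "r \<in> up_closure E J" "r e = 0"
        "\<forall>f\<in>E. r f \<in> {0, s f, t f}"
        using zero_convexD[OF Z U su st(3,4)] by blast
      then obtain u where u: "u \<in> J" "\<forall>f\<in>E. u f \<in> {0, r f}"
        by (auto simp: up_closure_def sign_le_def)
      show "\<exists>r\<in>J. r e = 0 \<and> (\<forall>f\<in>E. r f \<in> {0, s f, t f})"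
      proof (intro bexI[OF _ u(1)] conjI ballI)
        show "u e = 0" using u(2) st(3) r(2) by auto
        show "u f \<in> {0, s f, t f}" if "f \<in> E" for f using u(2) r(3)[rule_format, OF that] that by auto
      qed
    qed
  next
    assume Z: "zero_convex E J"
    show "zero_convex E (up_closure E J)"
    proof (rule zero_convexI[OF U])
      fix s t e assume st: "s \<in> up_closure E J" "t \<in> up_closure E J" "e \<in> E" "s e * t e < 0"
      then obtain s' t' where s': "s' \<in> J" "\<forall>f\<in>E. s' f \<in> {0, s f}"
        and t': "t' \<in> J" "\<forall>f\<in>E. t' f \<in> {0, t f}"
        by (auto simp: up_closure_def sign_le_def)
      have "\<exists>r\<in>J. r e = 0 \<and> (\<forall>f\<in>E. r f \<in> {0, s f, t f})"
      proof (cases "s' e = 0 \<or> t' e = 0")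
        case True
        then show ?thesis using s' t' by blast
      next
        case False
        then have "s' e = s e" "t' e = t e" using s'(2) t'(2) st(3) by auto
        then have "s' e * t' e < 0" using st(4) by simp
        then obtain r where r: "r \<in> J" "r e = 0" "\<forall>f\<in>E. r f \<in> {0, s' f, t' f}"
          using zero_convexD[OF Z J s'(1) t'(1) st(3)] by blast
        then have "\<forall>f\<in>E. r f \<in> {0, s f, t f}" using s'(2) t'(2) by fastforce
        then show ?thesis using r by blast
      qed
      then show "\<exists>r\<in>up_closure E J. r e = 0 \<and> (\<forall>f\<in>E. r f \<in> {0, s f, t f})"
        using subset_up_closure[OF J] by blast
    qed
  }
qed

lemma sign_convexD:
  assumes "sign_convex E U" "U \<subseteq> sign0_maps E" "s \<in> U" "t \<in> U" "e \<in> E" "s e * t e < 0"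
  shows "\<exists>r\<in>U. r e = 0 \<and> (\<forall>f\<in>E. s f * t f \<ge> 0 \<longrightarrow> r f \<in> {s f, t f})"
proof -
  have "s \<noteq> t" using assms(6) by (auto simp: mult_less_0_iff)
  then obtain r where r: "r \<in> U" "r e = 0"
      "\<forall>f\<in>E. s f * t f \<ge> 0 \<longrightarrow> sgn (r f) \<in> {sgn (s f), sgn (t f)}"
    using assms unfolding sign_convex_def by blast
  have "r f \<in> {s f, t f}" if f: "f \<in> E" "s f * t f \<ge> 0" for f
  proof -
    have "sgn (r f) \<in> {sgn (s f), sgn (t f)}" using r(3) f by blast
    then show ?thesis using sgn_sign0[OF _ f(1)] assms(2,3,4) r(1) by (simp add: subset_iff)
  qed
  then show ?thesis using r by blast
qed

lemma sign_convex_iff_zero_convex: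
  assumes U: "up_set E U"
  shows "sign_convex E U \<longleftrightarrow> zero_convex E U"
proof
  have sub: "U \<subseteq> sign0_maps E" using U by (simp add: up_set_def)
  {
    assume S: "sign_convex E U"
    show "zero_convex E U"
    proof (rule zero_convexI[OF sub])
      fix s t e assume st: "s \<in> U" "t \<in> U" "e \<in> E" "s e * t e < 0"
      obtain r where r: "r \<in> U" "r e = 0" "\<forall>f\<in>E. s f * t f \<ge> 0 \<longrightarrow> r f \<in> {s f, t f}"
        using sign_convexD[OF S sub st] by blast
      have "r f \<in> {0, s f, t f}" if f: "f \<in> E" for f
        using r(3)[rule_format, OF f] sign0_mapsD[OF subsetD[OF sub st(1)] f]
          sign0_mapsD[OF subsetD[OF sub st(2)] f] sign0_mapsD[OF subsetD[OF sub r(1)] f]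
        by (cases "s f * t f \<ge> 0") auto
      then show "\<exists>r\<in>U. r e = 0 \<and> (\<forall>f\<in>E. r f \<in> {0, s f, t f})" using r by blast
    qed
  next
    assume Z: "zero_convex E U"
    show "sign_convex E U" unfolding sign_convex_def
    proof (intro ballI impI)
      fix s t e assume st: "s \<in> U" "t \<in> U" "e \<in> E" "s e * t e < 0"
      obtain r where r: "r \<in> U" "r e = 0" "\<forall>f\<in>E. r f \<in> {0, s f, t f}"
        using zero_convexD[OF Z sub st] by blast
      \<comment> \<open>\<open>u\<close> composes \<open>s\<close> and \<open>t\<close> but stays 0
        where their signs are opposite, so filling with it keeps the zero at
        \<open>e\<close>.\<close>
      define u where "u = (\<lambda>f\<in>E. if s f * t f < 0 then 0 else if s f \<noteq> 0 then s f else t f)"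
      have "u \<in> sign0_maps E" unfolding u_def
        using sub st by (intro restrict_in_sign0_maps) (auto dest: sign0_mapsD subsetD)
      then have "fill E r u \<in> U" using up_set_fill[OF U r(1)] by blast
      moreover have "fill E r u e = 0" using st r(2) by (simp add: fill_def u_def)
      moreover have "fill E r u f \<in> {s f, t f}" if "f \<in> E" "s f * t f \<ge> 0" for f
        using r(3)[rule_format, OF that(1)] that by (auto simp: fill_def u_def)
      ultimately show "\<exists>r\<in>U. r e = 0 \<and> (\<forall>f\<in>E. 0 \<le> s f * t f \<longrightarrow> sgn (r f) \<in> {sgn (s f), sgn (t f)})"
        by (intro bexI[of _ "fill E r u"]) (auto, fastforce)
    qed
  }
qed

subsection \<open>Betweenness and the grid graph\<close>

lemma l1_dist_commute: "l1_dist E x y = l1_dist E y x"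
  by (simp add: l1_dist_def abs_minus_commute)

lemma l1_dist_triangle: "l1_dist E x z \<le> l1_dist E x y + l1_dist E y z"
  unfolding l1_dist_def sum.distrib[symmetric] by (rule sum_mono) simp

text \<open>The excess in the triangle inequality is a sum of nonnegative excesses of the
  coordinates.\<close>

lemma l1_dist_between_iff:
  assumes "finite E"
  shows "l1_dist E x y = l1_dist E x r + l1_dist E r y \<longleftrightarrow>
    (\<forall>e\<in>E. \<bar>x e - y e\<bar> = \<bar>x e - r e\<bar> + \<bar>r e - y e\<bar>)"
proof -
  have "l1_dist E x r + l1_dist E r y - l1_dist E x y =
      (\<Sum>e\<in>E. \<bar>x e - r e\<bar> + \<bar>r e - y e\<bar> - \<bar>x e - y e\<bar>)"
    by (simp add: l1_dist_def sum.distrib sum_subtractf)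
  moreover have "(\<Sum>e\<in>E. \<bar>x e - r e\<bar> + \<bar>r e - y e\<bar> - \<bar>x e - y e\<bar>) = 0 \<longleftrightarrow>
      (\<forall>e\<in>E. \<bar>x e - r e\<bar> + \<bar>r e - y e\<bar> - \<bar>x e - y e\<bar> = 0)"
    by (intro sum_nonneg_eq_0_iff assms) auto
  ultimately show ?thesis by (smt (verit, best))
qed

lemma l1_dist_single:
  assumes "finite E" "e \<in> E" "\<And>f. f \<in> E \<Longrightarrow> f \<noteq> e \<Longrightarrow> x f = y f"
  shows "l1_dist E x y = \<bar>x e - y e\<bar>"
proof -
  have "l1_dist E x y = \<bar>x e - y e\<bar> + (\<Sum>f\<in>E - {e}. \<bar>x f - y f\<bar>)"
    unfolding l1_dist_def using assms(1,2) by (rule sum.remove)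
  then show ?thesis using assms(3) by simp
qed

lemma l1_dist_nat:
  assumes "s \<in> sign0_maps E" "t \<in> sign0_maps E"
  shows "\<exists>n. l1_dist E s t = real n"
proof -
  have "\<bar>s e - t e\<bar> = real (nat \<lfloor>\<bar>s e - t e\<bar>\<rfloor>)" if "e \<in> E" for e
    using assms that by (auto dest!: sign0_mapsD)
  then have "l1_dist E s t = real (\<Sum>e\<in>E. nat \<lfloor>\<bar>s e - t e\<bar>\<rfloor>)"
    unfolding l1_dist_def by simp
  then show ?thesis by blast
qed

lemma l1_dist_pos:
  assumes "finite E" "s \<in> real_maps E" "t \<in> real_maps E" "s \<noteq> t"
  shows "l1_dist E s t > 0"
proof -
  interpret Metric_space "real_maps E" "l1_dist E"
    using assms(1) by (rule Metric_space_l1_dist) simp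
  show ?thesis using assms(2-4) mdist_pos_eq by blast
qed

lemma sign0_maps_subset_real_maps: "sign0_maps E \<subseteq> real_maps E"
  by (auto simp: sign0_maps_def real_maps_def PiE_iff)

lemma l1_dist_ge_1:
  assumes "finite E" "s \<in> sign0_maps E" "t \<in> sign0_maps E" "s \<noteq> t"
  shows "l1_dist E s t \<ge> 1"
proof -
  obtain n where "l1_dist E s t = real n" using l1_dist_nat[OF assms(2,3)] by blast
  then show ?thesis using l1_dist_pos[of E s t] assms sign0_maps_subset_real_maps by force
qed

text \<open>Copying an entry of \<open>t\<close> into a zero of \<open>s\<close> goes up, hence
  stays in \<open>U\<close>, and goes towards \<open>t\<close>. A distance above 1 prevents the
  result from being \<open>t\<close> itself.\<close>

lemma between_raise:
  assumes "finite E" and U: "up_set E U" and st: "s \<in> U" "t \<in> U" "l1_dist E s t > 1"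
    and e: "e \<in> E" "s e = 0" "t e \<noteq> 0"
  shows "\<exists>r\<in>U. r \<noteq> s \<and> r \<noteq> t \<and> l1_dist E s t = l1_dist E s r + l1_dist E r t"
proof -
  have t: "t e = -1 \<or> t e = 0 \<or> t e = 1" by (rule sign0_mapsD[OF up_set_sign0[OF U st(2)] e(1)])
  let ?r = "s(e := t e)"
  have "?r \<in> U" using up_set_fun_upd[OF U st(1) e(1,2)] t by blast
  moreover have "?r \<noteq> s" using e by (metis fun_upd_same)
  moreover have "?r \<noteq> t"
  proof
    assume r: "?r = t"
    have "s f = t f" if "f \<noteq> e" for f using fun_cong[OF r, of f] that by simp
    then have "l1_dist E s t = \<bar>s e - t e\<bar>"
      using l1_dist_single[OF assms(1) e(1)] by blast
    then show False using st(3) e(2) t by linarith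
  qed
  moreover have "l1_dist E s t = l1_dist E s ?r + l1_dist E ?r t"
    by (subst l1_dist_between_iff[OF assms(1)]) simp
  ultimately show ?thesis by blast
qed

text \<open>If the zeros of \<open>s\<close> and \<open>t\<close> differ, one of the two can be
  raised. Otherwise they differ only by opposite signs, and a sign-convexity witness lies between
  them.\<close>

lemma grid_menger_if_sign_convex:
  assumes "finite E" and U: "up_set E U" and S: "sign_convex E U"
  shows "grid_menger E U"
  unfolding grid_menger_def
proof (intro ballI impI)
  fix s t assume st: "s \<in> U" "t \<in> U" "l1_dist E s t > 1"
  have sub: "U \<subseteq> sign0_maps E" using U by (simp add: up_set_def)
  note v = sign0_mapsD[OF subsetD[OF sub]]
  consider (s) e where "e \<in> E" "s e = 0" "t e \<noteq> 0" | (t) e where "e \<in> E" "t e = 0" "s e \<noteq> 0"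
    | (eq) "\<forall>e\<in>E. s e = 0 \<longleftrightarrow> t e = 0" by blast
  then show "\<exists>r\<in>U. r \<noteq> s \<and> r \<noteq> t \<and> l1_dist E s t = l1_dist E s r + l1_dist E r t"
  proof cases
    case s
    then show ?thesis using between_raise[OF assms(1) U st] by blast
  next
    case t
    then show ?thesis using between_raise[OF assms(1) U st(2,1), of e] st(3)
      by (metis add.commute l1_dist_commute)
  next
    case eq
    have "\<exists>e\<in>E. s e \<noteq> t e"
      using st(3) by (rule_tac ccontr) (simp add: l1_dist_def)
    then obtain e where e: "e \<in> E" "s e \<noteq> t e" by blast
    then have opp: "s e * t e < 0" using eq v[OF st(1) e(1)] v[OF st(2) e(1)] by auto
    obtain r where r: "r \<in> U" "r e = 0" "\<forall>f\<in>E. s f * t f \<ge> 0 \<longrightarrow> r f \<in> {s f, t f}"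
      using sign_convexD[OF S sub st(1,2) e(1) opp] by blast
    have "\<bar>s f - t f\<bar> = \<bar>s f - r f\<bar> + \<bar>r f - t f\<bar>" if f: "f \<in> E" for f
      using r(3)[rule_format, OF f] v[OF st(1) f] v[OF st(2) f] v[OF r(1) f] eq f by auto
    then have "l1_dist E s t = l1_dist E s r + l1_dist E r t"
      using l1_dist_between_iff[OF assms(1)] by blast
    moreover have "r \<noteq> s" "r \<noteq> t" using opp r(2) by auto
    ultimately show ?thesis using r(1) by blast
  qed
qed

text \<open>While \<open>t\<close> is farther than 1 from \<open>s\<close>, it is replaced by an
  intermediate point. Grid distances are integers, so this ends at a neighbour of
  \<open>s\<close>.\<close>

lemma grid_neighbour:
  assumes "finite E" and U: "U \<subseteq> sign0_maps E" and M: "grid_menger E U"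
    and "s \<in> U" "t \<in> U" "s \<noteq> t"
  shows "\<exists>r\<in>U. l1_dist E s r = 1 \<and> l1_dist E s t = 1 + l1_dist E r t"
proof -
  obtain n where "l1_dist E s t = real n"
    using l1_dist_nat[OF subsetD[OF U assms(4)] subsetD[OF U assms(5)]] by blast
  then show ?thesis using assms(5,6)
  proof (induction n arbitrary: t rule: less_induct)
    case (less n)
    have sm: "s \<in> sign0_maps E" "t \<in> sign0_maps E" using assms(4) less.prems U by auto
    show ?case
    proof (cases "l1_dist E s t > 1")
      case False
      then have "l1_dist E s t = 1" using l1_dist_ge_1[OF assms(1) sm less.prems(3)] by simp
      then show ?thesis using less.prems(2) by (intro bexI[of _ t]) (auto simp: l1_dist_def)
    next
      case True
      then obtain r where r: "r \<in> U" "r \<noteq> s" "r \<noteq> t" "l1_dist E s t = l1_dist E s r + l1_dist E r t"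
        using M assms(4) less.prems(2) unfolding grid_menger_def by blast
      obtain m where m: "l1_dist E s r = real m"
        using l1_dist_nat[OF subsetD[OF U assms(4)] subsetD[OF U r(1)]] by blast
      have "l1_dist E r t \<ge> 1" using l1_dist_ge_1[OF assms(1) _ sm(2) r(3)] r(1) U by blast
      then have "m < n" using less.prems(1) r(4) m by simp
      then obtain q where q: "q \<in> U" "l1_dist E s q = 1" "l1_dist E s r = 1 + l1_dist E q r"
        using less.IH[OF _ m r(1)] r(2) by blast
      \<comment> \<open>\<open>q\<close> lies between \<open>s\<close> and \<open>r\<close>, and
        \<open>r\<close> between \<open>s\<close> and \<open>t\<close>; hence \<open>q\<close> lies
        between \<open>s\<close> and \<open>t\<close>.\<close>
      have "l1_dist E s t = 1 + l1_dist E q t"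
        using q r(4) l1_dist_triangle[of E q t r] l1_dist_triangle[of E s t q] by linarith
      then show ?thesis using q by blast
    qed
  qed
qed

text \<open>The arbitrary vertex \<open>x\<close> makes the bound serve two purposes: a geodesic
  prolonged at its start does not revisit a vertex, and every vertex of a geodesic lies between its
  end points.\<close>

lemma grid_walk_dist:
  assumes "finite E" "set p \<subseteq> sign0_maps E" "successively (grid_adj E) p" "x \<in> set p"
  shows "l1_dist E (hd p) x + l1_dist E x (last p) \<le> real (length p - 1)"
  using assms(2-4)
proof (induction p arbitrary: x rule: induct_list012)
  case (3 a b p)
  have ab: "l1_dist E a b = 1" using 3 grid_adj_iff_l1_dist[OF assms(1), of a b] by auto
  have IH: "l1_dist E b y + l1_dist E y (last (b # p)) \<le> real (length (b # p) - 1)"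
    if "y \<in> set (b # p)" for y using 3(2)[of y] 3(3-) that by auto
  show ?case
  proof (cases "x = a")
    case True
    then show ?thesis
      using IH[of b] ab l1_dist_triangle[of E a "last (b # p)" b] by (simp add: l1_dist_def)
  next
    case False
    then show ?thesis using IH[of x] 3(5) ab l1_dist_triangle[of E a x b] by simp
  qed
qed (auto simp: l1_dist_def)

lemma grid_isometric_if_menger:
  assumes "finite E" and U: "U \<subseteq> sign0_maps E" and M: "grid_menger E U"
  shows "grid_isometric E U"
  unfolding grid_isometric_def
proof (intro ballI)
  fix s t assume st: "s \<in> U" "t \<in> U"
  obtain n where "l1_dist E s t = real n"
    using l1_dist_nat[OF subsetD[OF U st(1)] subsetD[OF U st(2)]] by blast
  then show "\<exists>p. p \<noteq> [] \<and> hd p = s \<and> last p = t \<and> distinct p \<and> set p \<subseteq> U \<and>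
      successively (grid_adj E) p \<and> real (length p - 1) = l1_dist E s t"
    using st(1)
  proof (induction n arbitrary: s)
    case 0
    then have "s = t" using l1_dist_pos[OF assms(1), of s t] st(2) U sign0_maps_subset_real_maps by force
    then show ?case using 0 by (intro exI[of _ "[t]"]) auto
  next
    case (Suc n)
    then have "s \<noteq> t" by (auto simp: l1_dist_def)
    then obtain r where r: "r \<in> U" "l1_dist E s r = 1" "l1_dist E s t = 1 + l1_dist E r t"
      using grid_neighbour[OF assms Suc.prems(2) st(2)] by blast
    then obtain p where p: "p \<noteq> []" "hd p = r" "last p = t" "distinct p" "set p \<subseteq> U"
        "successively (grid_adj E) p" "real (length p - 1) = l1_dist E r t"
      using Suc.IH[of r] Suc.prems(1) by auto
    \<comment> \<open>A vertex \<open>s\<close> on a shortest path from \<open>r\<close> to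
      \<open>t\<close> would be no farther from \<open>t\<close> than \<open>r\<close>, but it is
      farther by 1.\<close>
    have "s \<notin> set p"
    proof
      assume "s \<in> set p"
      then have "l1_dist E r s + l1_dist E s t \<le> real (length p - 1)"
        using grid_walk_dist[OF assms(1) _ p(6)] p(2,3,5) U by blast
      then show False using p(7) r l1_dist_commute[of E r s] by simp
    qed
    moreover have "grid_adj E s r"
      using grid_adj_iff_l1_dist[OF assms(1), of s r] r Suc.prems(2) U by auto
    ultimately show ?case using p r Suc.prems(2)
      by (intro exI[of _ "s # p"]) (auto simp: successively_Cons Suc_le_eq of_nat_diff)
  qed
qed

text \<open>A discrete intermediate value argument: no edge joins -1 to 1 in a coordinate.\<close>

lemma grid_walk_zero:
  assumes "successively (grid_adj E) p" "p \<noteq> []" "e \<in> E" "hd p e * last p e < 0"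
  shows "\<exists>r\<in>set p. r e = 0"
  using assms
proof (induction p rule: induct_list012)
  case (2 a)
  then show ?case by (auto simp: mult_less_0_iff)
next
  case (3 a b p)
  have "a e = b e \<or> a e = 0 \<or> b e = 0" using 3(3,5) by (auto simp: grid_adj_def)
  then show ?case using 3 by auto
qed simp

text \<open>A vertex of a shortest path that vanishes at \<open>e\<close> lies between
  \<open>s\<close> and \<open>t\<close> in every coordinate, and a grid value between two others is
  one of them or 0.\<close>

lemma zero_convex_if_isometric:
  assumes "finite E" and U: "U \<subseteq> sign0_maps E" and G: "grid_isometric E U"
  shows "zero_convex E U"
proof (rule zero_convexI[OF U])
  fix s t e assume st: "s \<in> U" "t \<in> U" "e \<in> E" "s e * t e < 0"
  obtain p where p: "p \<noteq> []" "hd p = s" "last p = t" "set p \<subseteq> U"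
      "successively (grid_adj E) p" "real (length p - 1) = l1_dist E s t"
    using G st(1,2) unfolding grid_isometric_def by blast
  then obtain r where r: "r \<in> set p" "r e = 0" using grid_walk_zero[of E p e] st by auto
  have "l1_dist E s r + l1_dist E r t \<le> l1_dist E s t"
    using grid_walk_dist[OF assms(1) _ p(5) r(1)] p U by simp
  then have "l1_dist E s t = l1_dist E s r + l1_dist E r t"
    using l1_dist_triangle[of E s t r] by simp
  then have b: "\<bar>s f - t f\<bar> = \<bar>s f - r f\<bar> + \<bar>r f - t f\<bar>" if "f \<in> E" for f
    using l1_dist_between_iff[OF assms(1)] that by blast
  have rU: "r \<in> U" using r p by blast
  have "r f \<in> {0, s f, t f}" if f: "f \<in> E" for f
    using b[OF f] sign0_mapsD[OF subsetD[OF U st(1)] f] sign0_mapsD[OF subsetD[OF U st(2)] f]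
      sign0_mapsD[OF subsetD[OF U rU] f]
    by auto
  then show "\<exists>r\<in>U. r e = 0 \<and> (\<forall>f\<in>E. r f \<in> {0, s f, t f})" using r rU by blast
qed

subsection \<open>Weak convexity of the cubical complex\<close>

lemma smallest_face_iff:
  assumes "t \<in> sign0_maps E"
  shows "smallest_face E t = {r \<in> solid_cube E. \<forall>f\<in>E. t f \<noteq> 0 \<longrightarrow> r f = t f}"
proof -
  have "restrict r (E - {x \<in> E. t x = 0}) = restrict t (E - {x \<in> E. t x = 0}) \<longleftrightarrow>
      (\<forall>f\<in>E. t f \<noteq> 0 \<longrightarrow> r f = t f)" for r :: "'a \<Rightarrow> real"
    by (auto simp: restrict_def fun_eq_iff)
  then show ?thesis by (simp add: smallest_face_eq(1)[OF assms] cube_face_def)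
qed

lemma solid_cubeD: "x \<in> solid_cube E \<Longrightarrow> e \<in> E \<Longrightarrow> \<bar>x e\<bar> \<le> 1"
  by (auto simp: solid_cube_def PiE_iff abs_le_iff)

lemma solid_cube_subset: "solid_cube E \<subseteq> real_maps E"
  by (auto simp: solid_cube_def real_maps_def PiE_iff)

lemma sign0_maps_subset_solid_cube: "sign0_maps E \<subseteq> solid_cube E"
  by (force simp: solid_cube_def sign0_maps_def PiE_iff)

lemma round_sign_in_sign0_maps: "round_sign E x \<in> sign0_maps E"
  unfolding round_sign_def by (rule restrict_in_sign0_maps) auto

lemma round_sign_sign0: "t \<in> sign0_maps E \<Longrightarrow> round_sign E t = t"
  by (rule sign0_maps_eqI[OF round_sign_in_sign0_maps])
    (auto simp: round_sign_def dest: sign0_mapsD)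

text \<open>\<open>F(t)\<close> contains \<open>x\<close> iff \<open>t\<close> lies below the
  barycenter of the smallest face of \<open>x\<close>. Hence the union depends on the upward closure
  only.\<close>

lemma face_union_iff:
  assumes "J \<subseteq> sign0_maps E"
  shows "face_union E J = {x \<in> solid_cube E. round_sign E x \<in> up_closure E J}"
proof -
  have "x \<in> smallest_face E t \<longleftrightarrow> x \<in> solid_cube E \<and> sign_le E t (round_sign E x)"
    if "t \<in> J" for x t
  proof -
    have t: "t \<in> sign0_maps E" using assms that by blast
    have "(t f \<noteq> 0 \<longrightarrow> x f = t f) \<longleftrightarrow> t f \<in> {0, round_sign E x f}" if "f \<in> E" for f
      using sign0_mapsD[OF t that] that by (auto simp: round_sign_def)
    then show ?thesis by (auto simp: smallest_face_iff[OF t] sign_le_def)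
  qed
  then show ?thesis
    using round_sign_in_sign0_maps by (auto simp: face_union_def up_closure_def)
qed

lemma up_closure_up_set: "up_set E U \<Longrightarrow> up_closure E U = U"
  using subset_up_closure[of U E] by (auto simp: up_closure_def up_set_def)

lemma face_union_up_closure:
  assumes "J \<subseteq> sign0_maps E"
  shows "face_union E (up_closure E J) = face_union E J"
proof -
  have "up_closure E J \<subseteq> sign0_maps E" by (auto simp: up_closure_def)
  then show ?thesis
    using face_union_iff[OF assms] face_union_iff up_closure_up_set[OF up_set_up_closure] by metis
qed

lemma face_union_up_set:
  "up_set E U \<Longrightarrow> face_union E U = {x \<in> solid_cube E. round_sign E x \<in> U}"
  by (subst face_union_iff) (auto simp: up_set_def up_closure_up_set)

text \<open>An intermediate point of the complex is rounded to a grid point. If rounding falls back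
  on an end point, that end point can be raised instead.\<close>

lemma grid_menger_if_weakly_convex:
  assumes "finite E" and U: "up_set E U" and W: "weakly_convex E (face_union E U)"
  shows "grid_menger E U"
  unfolding grid_menger_def
proof (intro ballI impI)
  fix s t assume st: "s \<in> U" "t \<in> U" "l1_dist E s t > 1"
  note FU = face_union_up_set[OF U]
  have sm: "s \<in> sign0_maps E" "t \<in> sign0_maps E" using up_set_sign0[OF U] st by auto
  have "s \<in> face_union E U" "t \<in> face_union E U"
    using st sm round_sign_sign0 sign0_maps_subset_solid_cube by (auto simp: FU)
  moreover have "s \<noteq> t" using st(3) by (auto simp: l1_dist_def)
  ultimately obtain x where x: "x \<in> face_union E U" "x \<noteq> s" "x \<noteq> t"
      "l1_dist E s t = l1_dist E s x + l1_dist E x t"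
    using W unfolding weakly_convex_def by blast
  have b: "\<bar>s e - t e\<bar> = \<bar>s e - x e\<bar> + \<bar>x e - t e\<bar>" if "e \<in> E" for e
    using x(4) that l1_dist_between_iff[OF assms(1)] by blast
  let ?r = "round_sign E x"
  have r: "?r \<in> U" and xc: "x \<in> solid_cube E" using x(1) by (auto simp: FU)
  \<comment> \<open>Rounding preserves betweenness: an interval with ends in {-1, 0, 1} that
    contains a value of modulus below 1 also contains 0.\<close>
  have "\<bar>s e - t e\<bar> = \<bar>s e - ?r e\<bar> + \<bar>?r e - t e\<bar>" if e: "e \<in> E" for e
    using sign0_mapsD[OF sm(1) e] sign0_mapsD[OF sm(2) e] b[OF e] e
    by (auto simp: round_sign_def)
  then have br: "l1_dist E s t = l1_dist E s ?r + l1_dist E ?r t"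
    using l1_dist_between_iff[OF assms(1)] by blast
  (* If x rounds to an end point u, then x leaves u in a coordinate where u is 0 and the
     other end point is not. *)
  have raise: "\<exists>e\<in>E. u e = 0 \<and> v e \<noteq> 0" if u: "?r = u" "x \<noteq> u" "u \<in> sign0_maps E"
    and buv: "\<And>e. e \<in> E \<Longrightarrow> \<bar>u e - v e\<bar> = \<bar>u e - x e\<bar> + \<bar>x e - v e\<bar>" for u v
  proof -
    have "u \<in> solid_cube E" using u(3) sign0_maps_subset_solid_cube by blast
    then obtain e where e: "e \<in> E" "x e \<noteq> u e"
      using u(2) xc unfolding solid_cube_def by (meson PiE_ext)
    have "u e = (if \<bar>x e\<bar> = 1 then x e else 0)"
      using u(1) e(1) by (auto simp: round_sign_def)
    then have "u e = 0" "x e \<noteq> 0" using e(2) by (auto split: if_splits)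
    then have "v e \<noteq> 0" using buv[OF e(1)] by auto
    then show ?thesis using e(1) \<open>u e = 0\<close> by blast
  qed
  consider "?r \<noteq> s" "?r \<noteq> t" | "?r = s" | "?r = t" by blast
  then show "\<exists>r\<in>U. r \<noteq> s \<and> r \<noteq> t \<and> l1_dist E s t = l1_dist E s r + l1_dist E r t"
  proof cases
    case 1
    then show ?thesis using r br by blast
  next
    case 2
    then obtain e where "e \<in> E" "s e = 0" "t e \<noteq> 0" using raise[of s t] x(2) sm(1) b by blast
    then show ?thesis using between_raise[OF assms(1) U st] by blast
  next
    case 3
    have "\<bar>t e - s e\<bar> = \<bar>t e - x e\<bar> + \<bar>x e - s e\<bar>" if "e \<in> E" for e
      using b[OF that] by (simp add: abs_minus_commute)
    then obtain e where "e \<in> E" "t e = 0" "s e \<noteq> 0" using raise[OF 3 x(3) sm(2)] by blast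
    then show ?thesis using between_raise[OF assms(1) U st(2,1), of e] st(3)
      by (metis add.commute l1_dist_commute)
  qed
qed

section \<open>Completeness of the complex and the return to weak convexity\<close>

lemma l1_dist_coord_le: "finite E \<Longrightarrow> e \<in> E \<Longrightarrow> \<bar>x e - y e\<bar> \<le> l1_dist E x y"
  unfolding l1_dist_def by (rule member_le_sum) auto

text \<open>Cauchy sequences converge in each coordinate. The rounded terms eventually lie below the
  rounded limit, which is therefore in the up-set \<open>U\<close>.\<close>

lemma mcomplete_face_union:
  assumes "finite E" and U: "up_set E U"
  shows "Metric_space.mcomplete (face_union E U) (l1_dist E)"
proof -
  let ?K = "face_union E U"
  note FU = face_union_up_set[OF U]
  interpret Metric_space ?K "l1_dist E"
    using assms(1) by (rule Metric_space_l1_dist) (use FU solid_cube_subset in blast)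
  show ?thesis unfolding mcomplete_def
  proof (intro allI impI)
    fix \<sigma> assume C: "MCauchy \<sigma>"
    have K: "\<sigma> n \<in> ?K" for n using C unfolding MCauchy_def by auto
    then have cube: "\<sigma> n \<in> solid_cube E" "round_sign E (\<sigma> n) \<in> U" for n by (auto simp: FU)
    have "\<exists>l. (\<lambda>n. \<sigma> n e) \<longlonglongrightarrow> l" if e: "e \<in> E" for e
    proof -
      have "Cauchy (\<lambda>n. \<sigma> n e)" unfolding Cauchy_def dist_real_def
      proof (intro allI impI)
        fix \<epsilon> :: real assume "\<epsilon> > 0"
        then obtain N where "\<forall>n n'. N \<le> n \<longrightarrow> N \<le> n' \<longrightarrow> l1_dist E (\<sigma> n) (\<sigma> n') < \<epsilon>"
          using C unfolding MCauchy_def by blast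
        then show "\<exists>M. \<forall>m\<ge>M. \<forall>n\<ge>M. \<bar>\<sigma> m e - \<sigma> n e\<bar> < \<epsilon>"
          using l1_dist_coord_le[OF assms(1) e] by (meson le_less_trans)
      qed
      then show ?thesis using Cauchy_convergent convergent_def by blast
    qed
    then obtain l where l: "\<And>e. e \<in> E \<Longrightarrow> (\<lambda>n. \<sigma> n e) \<longlonglongrightarrow> l e" by metis
    define x where "x = restrict l E"
    have x: "(\<lambda>n. \<sigma> n e) \<longlonglongrightarrow> x e" if "e \<in> E" for e using l[OF that] that by (simp add: x_def)
    have "-1 \<le> x e \<and> x e \<le> 1" if "e \<in> E" for e
    proof
      have "\<bar>\<sigma> n e\<bar> \<le> 1" for n using solid_cubeD[OF cube(1) that] .
      then have "\<forall>n. -1 \<le> \<sigma> n e" "\<forall>n. \<sigma> n e \<le> 1" by (auto simp: abs_le_iff minus_le_iff)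
      then show "-1 \<le> x e" "x e \<le> 1"
        using LIMSEQ_le_const[OF x[OF that]] LIMSEQ_le_const2[OF x[OF that]] by auto
    qed
    then have xc: "x \<in> solid_cube E" by (auto simp: solid_cube_def x_def PiE_iff)
    \<comment> \<open>Near a limit of modulus 1, rounding yields that sign or 0; near an interior
      limit it yields only 0.\<close>
    have "\<forall>\<^sub>F n in sequentially. round_sign E (\<sigma> n) e \<in> {0, round_sign E x e}" if e: "e \<in> E" for e
    proof (cases "\<bar>x e\<bar> = 1")
      case True
      have "\<forall>\<^sub>F n in sequentially. dist (\<sigma> n e) (x e) < 1"
        using x[OF e] by (rule tendstoD) simp
      then show ?thesis
        by eventually_elim (use True e in \<open>auto simp: round_sign_def dist_real_def abs_if split: if_splits\<close>)
    next
      case False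
      then have "\<bar>x e\<bar> < 1" using solid_cubeD[OF xc e] by simp
      moreover have "(\<lambda>n. \<bar>\<sigma> n e\<bar>) \<longlonglongrightarrow> \<bar>x e\<bar>" using x[OF e] by (rule tendsto_rabs)
      ultimately have "\<forall>\<^sub>F n in sequentially. \<bar>\<sigma> n e\<bar> < 1" by (rule order_tendstoD(2)[rotated])
      then show ?thesis by eventually_elim (use e in \<open>auto simp: round_sign_def\<close>)
    qed
    then have "\<forall>\<^sub>F n in sequentially. sign_le E (round_sign E (\<sigma> n)) (round_sign E x)"
      unfolding sign_le_def by (rule eventually_ball_finite[OF assms(1), rule_format])
    then obtain n where "sign_le E (round_sign E (\<sigma> n)) (round_sign E x)"
      using eventually_happens'[OF sequentially_bot] by blast
    then have "round_sign E x \<in> U"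
      using up_setD[OF U cube(2) round_sign_in_sign0_maps] by blast
    then have xK: "x \<in> ?K" using xc by (simp add: FU)
    have "(\<lambda>n. l1_dist E (\<sigma> n) x) \<longlonglongrightarrow> (\<Sum>e\<in>E. \<bar>x e - x e\<bar>)"
      unfolding l1_dist_def by (intro tendsto_intros x)
    then have "limitin mtopology \<sigma> x sequentially"
      unfolding limitin_metric_dist_null using xK K by simp
    then show "\<exists>x. limitin mtopology \<sigma> x sequentially" by blast
  qed
qed

text \<open>If the points differ in a coordinate where one of them is not extreme, that one can move
  along it. Otherwise they differ only by opposite values of modulus 1, and sign-convexity supplies
  an intermediate point.\<close>

lemma weakly_convex_if_sign_convex:
  assumes "finite E" and U: "up_set E U" and S: "sign_convex E U"
  shows "weakly_convex E (face_union E U)"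
  unfolding weakly_convex_def
proof (intro conjI ballI impI mcomplete_face_union[OF assms(1,2)])
  note FU = face_union_up_set[OF U]
  have sub: "U \<subseteq> sign0_maps E" using U by (simp add: up_set_def)
  let ?K = "face_union E U"
  have move: "\<exists>r\<in>?K. r \<noteq> x \<and> r \<noteq> y \<and> l1_dist E x y = l1_dist E x r + l1_dist E r y"
    if xy: "x \<in> ?K" "y \<in> ?K" and e: "e \<in> E" "x e \<noteq> y e" "\<bar>x e\<bar> \<noteq> 1" for x y e
  proof -
    let ?r = "x(e := (x e + y e) / 2)"
    have c: "\<bar>x e\<bar> \<le> 1" "\<bar>y e\<bar> \<le> 1" using solid_cubeD[of _ E e] xy e by (auto simp: FU)
    have "?r \<in> solid_cube E"
      using xy(1) e(1) c by (auto simp: FU solid_cube_def PiE_iff extensional_def abs_le_iff)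
    \<comment> \<open>The rounding of \<open>x\<close> is 0 at \<open>e\<close>, so a change of this
      coordinate can only raise it.\<close>
    moreover have "round_sign E ?r \<in> U"
      by (rule up_setD[OF U _ round_sign_in_sign0_maps, of "round_sign E x"])
        (use xy(1) e in \<open>auto simp: FU sign_le_def round_sign_def\<close>)
    ultimately have K: "?r \<in> ?K" by (simp add: FU)
    have "?r e \<noteq> x e" "?r e \<noteq> y e" using e(2) by (auto simp: field_simps)
    then have "?r \<noteq> x" "?r \<noteq> y" by metis+
    moreover have "l1_dist E x y = l1_dist E x ?r + l1_dist E ?r y"
      by (subst l1_dist_between_iff[OF assms(1)]) (auto simp: abs_if field_simps)
    ultimately show ?thesis using K by blast
  qed
  fix x y assume xy: "x \<in> ?K" "y \<in> ?K" "x \<noteq> y"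
  then have xc: "x \<in> solid_cube E" "y \<in> solid_cube E" by (auto simp: FU)
  consider (x) e where "e \<in> E" "x e \<noteq> y e" "\<bar>x e\<bar> \<noteq> 1" | (y) e where "e \<in> E" "x e \<noteq> y e" "\<bar>y e\<bar> \<noteq> 1"
    | (opp) "\<forall>e\<in>E. x e \<noteq> y e \<longrightarrow> \<bar>x e\<bar> = 1 \<and> \<bar>y e\<bar> = 1" by blast
  then show "\<exists>r\<in>?K. r \<noteq> x \<and> r \<noteq> y \<and> l1_dist E x y = l1_dist E x r + l1_dist E r y"
  proof cases
    case x
    then show ?thesis using move[OF xy(1,2)] by blast
  next
    case y
    then obtain r where "r \<in> ?K" "r \<noteq> y" "r \<noteq> x" "l1_dist E y x = l1_dist E y r + l1_dist E r x"
      using move[OF xy(2,1), of e] by metis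
    then show ?thesis by (metis add.commute l1_dist_commute)
  next
    case opp
    let ?s = "round_sign E x" and ?t = "round_sign E y"
    have st: "?s \<in> U" "?t \<in> U" using xy by (auto simp: FU)
    obtain e where e: "e \<in> E" "x e \<noteq> y e"
      using xy(3) xc unfolding solid_cube_def by (meson PiE_ext)
    have "?s e * ?t e < 0" using opp e by (auto simp: round_sign_def abs_if split: if_splits)
    then obtain r where r: "r \<in> U" "r e = 0" "\<forall>f\<in>E. ?s f * ?t f \<ge> 0 \<longrightarrow> r f \<in> {?s f, ?t f}"
      using sign_convexD[OF S sub st e(1)] by blast
    \<comment> \<open>\<open>r\<close> decides the coordinates in which \<open>x\<close> and
      \<open>y\<close> differ. Common entries are kept, even outside {-1, 0, 1}, and they round to
      those of \<open>r\<close>.\<close>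
    define z where "z = (\<lambda>f\<in>E. if x f = y f then x f else r f)"
    have v: "r f = -1 \<or> r f = 0 \<or> r f = 1" if "f \<in> E" for f
      using sign0_mapsD[OF subsetD[OF sub r(1)] that] .
    have z: "z \<in> solid_cube E"
      using xc(1) by (auto simp: z_def solid_cube_def PiE_iff dest: v)
    have "round_sign E z = r"
    proof (rule sign0_maps_eqI[OF round_sign_in_sign0_maps subsetD[OF sub r(1)]])
      fix f assume f: "f \<in> E"
      show "round_sign E z f = r f"
      proof (cases "x f = y f")
        case True
        then show ?thesis using r(3)[rule_format, OF f] f by (auto simp: z_def round_sign_def)
      next
        case False
        then show ?thesis using v[OF f] f by (auto simp: z_def round_sign_def)
      qed
    qed
    then have "z \<in> ?K" using z r(1) by (simp add: FU)
    moreover have "z \<noteq> x" "z \<noteq> y" using e r(2) opp by (auto simp: z_def dest!: fun_cong[of _ _ e])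
    moreover have "l1_dist E x y = l1_dist E x z + l1_dist E z y"
    proof (subst l1_dist_between_iff[OF assms(1)], rule ballI)
      fix f assume f: "f \<in> E"
      show "\<bar>x f - y f\<bar> = \<bar>x f - z f\<bar> + \<bar>z f - y f\<bar>"
        using opp v[OF f] f by (cases "x f = y f") (auto simp: z_def abs_if split: if_splits)
    qed
    ultimately show ?thesis by blast
  qed
qed

subsection \<open>Barycenters\<close>

lemma sign_maps_solid_cube: "sign_maps E \<subseteq> solid_cube E"
  using sign_maps_subset sign0_maps_subset_solid_cube by blast

lemma smallest_face_vertices:
  assumes "t \<in> sign0_maps E"
  shows "smallest_face E t \<inter> sign_maps E = {s \<in> sign_maps E. sign_le E t s}"
  using sign_maps_solid_cube by (auto simp: smallest_face_iff[OF assms] sign_le_def)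

lemma face_barycenter_in_sign0_maps:
  assumes "A \<subseteq> E" "s \<in> sign_maps (E - A)"
  shows "face_barycenter E A s \<in> sign0_maps E"
  unfolding face_barycenter_def
  by (rule restrict_in_sign0_maps) (use sign_mapsD[OF assms(2)] in auto)

lemma smallest_face_barycenter:
  assumes "A \<subseteq> E" "s \<in> sign_maps (E - A)"
  shows "smallest_face E (face_barycenter E A s) = cube_face E A s"
proof -
  let ?t = "face_barycenter E A s"
  have A: "{x \<in> E. ?t x = 0} = A"
    using assms(1) sign_mapsD[OF assms(2)] by (force simp: face_barycenter_def)
  have "restrict ?t (E - A) = s"
    using assms(2) by (auto simp: face_barycenter_def restrict_def sign_maps_def PiE_iff extensional_def)
  then show ?thesis
    using smallest_face_eq(1)[OF face_barycenter_in_sign0_maps[OF assms]] A by simp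
qed

lemma face_exists_barycenter:
  assumes "t \<in> sign0_maps E"
  obtains A s where "A \<subseteq> E" "s \<in> sign_maps (E - A)" "t = face_barycenter E A s"
    "smallest_face E t = cube_face E A s"
proof -
  let ?A = "{x \<in> E. t x = 0}"
  have "restrict t (E - ?A) \<in> sign_maps (E - ?A)"
    using assms by (fastforce simp: sign_maps_def sign0_maps_def)
  then show ?thesis
    using that[of ?A "restrict t (E - ?A)"] smallest_face_eq[OF assms] by auto
qed

text \<open>The vertices of the face with barycenter \<open>t\<close> are the sign maps above
  \<open>t\<close>, so the parametrisation of faces can be traded for the order.\<close>

lemma Baryc_eq:
  "Baryc E L = {t \<in> sign0_maps E. \<forall>s\<in>sign_maps E. sign_le E t s \<longrightarrow> s \<in> L}"
proof -
  have "t \<in> Baryc E L \<longleftrightarrow> t \<in> sign0_maps E \<and> smallest_face E t \<inter> sign_maps E \<subseteq> L" for t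
  proof
    assume "t \<in> Baryc E L"
    then show "t \<in> sign0_maps E \<and> smallest_face E t \<inter> sign_maps E \<subseteq> L"
      by (auto simp: Baryc_def smallest_face_barycenter face_barycenter_in_sign0_maps)
  next
    assume t: "t \<in> sign0_maps E \<and> smallest_face E t \<inter> sign_maps E \<subseteq> L"
    then obtain A s where "A \<subseteq> E" "s \<in> sign_maps (E - A)" "t = face_barycenter E A s"
      "smallest_face E t = cube_face E A s" using face_exists_barycenter by metis
    then show "t \<in> Baryc E L" using t unfolding Baryc_def by auto
  qed
  then show ?thesis using smallest_face_vertices by blast
qed

text \<open>With this, the identity of complexes follows from the identity of barycenter
  sets.\<close>

lemma cube_complex_eq: "cube_complex E L = face_union E (Baryc E L)"
proof
  show "cube_complex E L \<subseteq> face_union E (Baryc E L)"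
  proof
    fix x assume "x \<in> cube_complex E L"
    then obtain A s where F: "A \<subseteq> E" "s \<in> sign_maps (E - A)" "cube_face E A s \<inter> sign_maps E \<subseteq> L"
      "x \<in> cube_face E A s" by (auto simp: cube_complex_def cube_faces_def)
    then show "x \<in> face_union E (Baryc E L)" unfolding face_union_def Baryc_def
      using smallest_face_barycenter[OF F(1,2)] by blast
  qed
  show "face_union E (Baryc E L) \<subseteq> cube_complex E L"
  proof
    fix x assume "x \<in> face_union E (Baryc E L)"
    then obtain A s where F: "A \<subseteq> E" "s \<in> sign_maps (E - A)" "cube_face E A s \<inter> sign_maps E \<subseteq> L"
      "x \<in> smallest_face E (face_barycenter E A s)" by (auto simp: face_union_def Baryc_def)
    then show "x \<in> cube_complex E L" unfolding cube_complex_def cube_faces_def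
      using smallest_face_barycenter[OF F(1,2)] by blast
  qed
qed

lemma up_set_subset_Baryc: "up_set E U \<Longrightarrow> U \<subseteq> Baryc E (U \<inter> sign_maps E)"
  using sign_maps_subset[of E] unfolding Baryc_eq up_set_def by blast

text \<open>Induction on the number of zeros of \<open>t\<close>: giving one zero both signs
  produces two members of \<open>U\<close>, which 0-convexity merges again.\<close>

lemma Baryc_subset_zero_convex:
  assumes "finite E" and U: "up_set E U" and Z: "zero_convex E U"
  shows "Baryc E (U \<inter> sign_maps E) \<subseteq> U"
proof
  fix t assume "t \<in> Baryc E (U \<inter> sign_maps E)"
  then have t: "t \<in> sign0_maps E" "\<And>s. s \<in> sign_maps E \<Longrightarrow> sign_le E t s \<Longrightarrow> s \<in> U"
    by (auto simp: Baryc_eq)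
  have sub: "U \<subseteq> sign0_maps E" using U by (simp add: up_set_def)
  have "finite {e \<in> E. t e = 0}" using assms(1) by simp
  then show "t \<in> U" using t
  proof (induction "card {e \<in> E. t e = 0}" arbitrary: t)
    case 0
    then have "\<forall>e\<in>E. t e \<noteq> 0" by auto
    then have "t \<in> sign_maps E" using 0(3) by (auto simp: sign_maps_def sign0_maps_def PiE_iff)
    then show ?case using 0(4) by (simp add: sign_le_def)
  next
    case (Suc n)
    then obtain e where e: "e \<in> E" "t e = 0" by (metis (mono_tags, lifting) card_eq_0_iff empty_Collect_eq nat.simps(3))
    have "t(e := v) \<in> U" if v: "v = -1 \<or> v = 1" for v
    proof (rule Suc.hyps(1))
      have "{e' \<in> E. (t(e := v)) e' = 0} = {e' \<in> E. t e' = 0} - {e}" using v by auto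
      then show "n = card {e' \<in> E. (t(e := v)) e' = 0}" "finite {e' \<in> E. (t(e := v)) e' = 0}"
        using Suc.hyps(2) Suc.prems(1) e by auto
      show "t(e := v) \<in> sign0_maps E" using fun_upd_in_sign0_maps[OF Suc.prems(2) e(1)] v by auto
      show "s \<in> U" if "s \<in> sign_maps E" "sign_le E (t(e := v)) s" for s
        using Suc.prems(3)[OF that(1)] that(2) e by (fastforce simp: sign_le_def split: if_splits)
    qed
    then have "t(e := -1) \<in> U" "t(e := 1) \<in> U" by auto
    then obtain r where r: "r \<in> U" "r e = 0" "\<forall>f\<in>E. r f \<in> {0, (t(e := -1)) f, (t(e := 1)) f}"
      using zero_convexD[OF Z sub, of "t(e := -1)" "t(e := 1)" e] e(1) by auto
    \<comment> \<open>Off \<open>e\<close> both vectors equal \<open>t\<close>, so the merged vector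
      lies below \<open>t\<close>.\<close>
    then have "sign_le E r t" unfolding sign_le_def by (metis empty_iff fun_upd_other insert_iff)
    then show ?case using up_setD[OF U r(1) Suc.prems(2)] by blast
  qed
qed

subsection \<open>Shattering and ampleness\<close>

definition shattered_sets :: "'a set \<Rightarrow> ('a \<Rightarrow> real) set \<Rightarrow> 'a set set" where
  "shattered_sets E L = {A. A \<subseteq> E \<and> shattered_by L A}"

text \<open>The coordinate \<open>e\<close> is kept, so that a half is still a family on
  \<open>E\<close> and inductions need no change of ground set.\<close>

definition half :: "('a \<Rightarrow> real) set \<Rightarrow> 'a \<Rightarrow> real \<Rightarrow> ('a \<Rightarrow> real) set" where
  "half L e v = {u \<in> L. u e = v}"

lemma finite_shattered_sets: "finite E \<Longrightarrow> finite (shattered_sets E L)"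
  by (auto simp: shattered_sets_def)

lemma ample_iff: "ample E L \<longleftrightarrow> card L = card (shattered_sets E L)"
  by (simp add: ample_def shattered_sets_def)

lemma shattered_by_iff:
  assumes "L \<subseteq> sign_maps E" "A \<subseteq> E"
  shows "shattered_by L A \<longleftrightarrow> (\<forall>s\<in>sign_maps A. \<exists>u\<in>L. \<forall>f\<in>A. u f = s f)"
proof -
  have r: "restrict u A \<in> sign_maps A" if "u \<in> L" for u
    using assms that by (fastforce simp: sign_maps_def PiE_iff)
  have eq: "s = restrict u A \<longleftrightarrow> (\<forall>f\<in>A. u f = s f)" if "s \<in> sign_maps A" for s u
    using that by (auto simp: sign_maps_def PiE_iff extensional_def restrict_def fun_eq_iff)
  have "(\<lambda>u. restrict u A) ` L \<subseteq> sign_maps A" using r by blast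
  then have "shattered_by L A \<longleftrightarrow> sign_maps A \<subseteq> (\<lambda>u. restrict u A) ` L"
    unfolding shattered_by_def by blast
  also have "\<dots> \<longleftrightarrow> (\<forall>s\<in>sign_maps A. \<exists>u\<in>L. s = restrict u A)"
    by (simp only: subset_eq image_iff)
  also have "\<dots> \<longleftrightarrow> (\<forall>s\<in>sign_maps A. \<exists>u\<in>L. \<forall>f\<in>A. u f = s f)"
    by (intro ball_cong bex_cong refl eq)
  finally show ?thesis .
qed

lemma shattered_sets_iff:
  "L \<subseteq> sign_maps E \<Longrightarrow>
    A \<in> shattered_sets E L \<longleftrightarrow> A \<subseteq> E \<and> (\<forall>s\<in>sign_maps A. \<exists>u\<in>L. \<forall>f\<in>A. u f = s f)"
  using shattered_by_iff[of L E A] by (auto simp: shattered_sets_def)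

section \<open>Shattering by the two halves over a coordinate\<close>

lemma half_subset: "half L e v \<subseteq> L"
  by (auto simp: half_def)

lemma half_sign_maps: "L \<subseteq> sign_maps E \<Longrightarrow> half L e v \<subseteq> sign_maps E"
  by (auto simp: half_def)

lemma shattered_sets_mono:
  assumes "L' \<subseteq> L" "L \<subseteq> sign_maps E"
  shows "shattered_sets E L' \<subseteq> shattered_sets E L"
proof
  fix A assume "A \<in> shattered_sets E L'"
  moreover have "L' \<subseteq> sign_maps E" using assms by blast
  ultimately have "A \<subseteq> E" "\<forall>s\<in>sign_maps A. \<exists>u\<in>L'. \<forall>f\<in>A. u f = s f"
    using shattered_sets_iff[of L' E A] by simp_all
  then show "A \<in> shattered_sets E L"
    using shattered_sets_iff[OF assms(2), of A] assms(1) by blast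
qed

lemma restrict_in_sign_maps:
  "(\<And>e. e \<in> E \<Longrightarrow> g e = -1 \<or> g e = 1) \<Longrightarrow> restrict g E \<in> sign_maps E"
  by (auto simp: sign_maps_def)

lemma const_in_sign_maps: "v = -1 \<or> v = 1 \<Longrightarrow> (\<lambda>_\<in>A. v) \<in> sign_maps A"
  by (auto simp: sign_maps_def)

text \<open>The constant patterns 1 and -1 on \<open>A\<close> would force two values at
  \<open>e\<close>, where the half has only one.\<close>

lemma notin_shattered_half:
  assumes "L \<subseteq> sign_maps E" "A \<in> shattered_sets E (half L e v)"
  shows "e \<notin> A"
proof
  assume e: "e \<in> A"
  have *: "\<exists>u\<in>half L e v. \<forall>f\<in>A. u f = s f" if "s \<in> sign_maps A" for s
    using assms shattered_sets_iff[of "half L e v" E A] half_subset[of L e v] that by blast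
  show False
    using *[OF const_in_sign_maps[of 1 A]] *[OF const_in_sign_maps[of "-1" A]] e by (auto simp: half_def)
qed

text \<open>The value prescribed at \<open>e\<close> selects the half that realises the rest of the
  pattern.\<close>

lemma shattered_insert:
  assumes L: "L \<subseteq> sign_maps E" and "e \<in> E"
    and A: "A \<in> shattered_sets E (half L e (-1))" "A \<in> shattered_sets E (half L e 1)"
  shows "insert e A \<in> shattered_sets E L"
  unfolding shattered_sets_iff[OF L]
proof (intro conjI ballI)
  show "insert e A \<subseteq> E" using assms by (auto simp: shattered_sets_def)
  fix s assume s: "s \<in> sign_maps (insert e A)"
  have eA: "e \<notin> A" using notin_shattered_half[OF L A(1)] .
  have "restrict s A \<in> sign_maps A" using s by (auto simp: sign_maps_def PiE_iff)
  moreover have "s e = -1 \<or> s e = 1" using sign_mapsD[OF s] by blast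
  then have "A \<in> shattered_sets E (half L e (s e))" using A by (elim disjE) simp_all
  moreover have "half L e (s e) \<subseteq> sign_maps E" using half_sign_maps[OF L] .
  ultimately have "\<exists>u\<in>half L e (s e). \<forall>f\<in>A. u f = restrict s A f"
    using shattered_sets_iff[of "half L e (s e)" E A] by blast
  then obtain u where "u \<in> half L e (s e)" "\<forall>f\<in>A. u f = restrict s A f" by blast
  then show "\<exists>u\<in>L. \<forall>f\<in>insert e A. u f = s f" by (intro bexI[of _ u]) (auto simp: half_def)
qed

text \<open>Inclusion-exclusion: a set \<open>A\<close> shattered by both halves is counted a second
  time as \<open>insert e A\<close>, which is new since halves shatter no set containing
  \<open>e\<close>.\<close>

lemma card_shattered_halves:
  fixes e :: 'a
  assumes "finite E" "L \<subseteq> sign_maps E"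
  defines "P \<equiv> shattered_sets E (half L e 1)" and "N \<equiv> shattered_sets E (half L e (-1))"
  shows "card P + card N = card (P \<union> N \<union> insert e ` (P \<inter> N))"
proof -
  have fin: "finite P" "finite N" using assms(1) finite_shattered_sets by (auto simp: P_def N_def)
  have notin: "e \<notin> A" if "A \<in> P \<union> N" for A
    using that notin_shattered_half[OF assms(2)] by (auto simp: P_def N_def)
  then have "inj_on (insert e) (P \<inter> N)" by (intro inj_onI) (metis Diff_insert_absorb Int_iff UnI1)
  then have "card (insert e ` (P \<inter> N)) = card (P \<inter> N)" by (rule card_image)
  moreover have "(P \<union> N) \<inter> insert e ` (P \<inter> N) = {}" using notin by auto
  ultimately show ?thesis using card_Un_Int[OF fin] fin by (simp add: card_Un_disjoint)
qed

lemma shattered_halves_subset: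
  assumes L: "L \<subseteq> sign_maps E" and "e \<in> E"
  defines "P \<equiv> shattered_sets E (half L e 1)" and "N \<equiv> shattered_sets E (half L e (-1))"
  shows "P \<union> N \<union> insert e ` (P \<inter> N) \<subseteq> shattered_sets E L"
  using shattered_insert[OF L assms(2)] shattered_sets_mono[OF half_subset L]
  unfolding P_def N_def by blast

lemma card_halves:
  assumes "finite E" "L \<subseteq> sign_maps E" "e \<in> E"
  shows "card L = card (half L e 1) + card (half L e (-1))"
proof -
  have "L = half L e 1 \<union> half L e (-1)" using assms(2,3) by (auto simp: half_def dest: sign_mapsD subsetD)
  moreover have "finite L" using assms(1,2) finite_sign_maps finite_subset by blast
  moreover have "half L e 1 \<inter> half L e (-1) = {}" by (auto simp: half_def)
  ultimately show ?thesis by (metis card_Un_disjoint finite_Un)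
qed

lemma shattered_sets_empty: "L \<subseteq> sign_maps E \<Longrightarrow> {} \<in> shattered_sets E L \<longleftrightarrow> L \<noteq> {}"
  by (auto simp: shattered_sets_iff sign_maps_def)

(* The halves over a coordinate separating two elements of L are both smaller than L. *)
lemma halves_induct [consumes 2, case_names empty singleton halves]:
  assumes "finite E" "L \<subseteq> sign_maps E"
    and "P {}" and "\<And>s. s \<in> sign_maps E \<Longrightarrow> P {s}"
    and "\<And>L e. L \<subseteq> sign_maps E \<Longrightarrow> e \<in> E \<Longrightarrow> P (half L e 1) \<Longrightarrow> P (half L e (-1)) \<Longrightarrow> P L"
  shows "P L"
proof -
  have "finite L" using assms(1,2) finite_sign_maps finite_subset by blast
  then show ?thesis using assms(2)
  proof (induction L rule: finite_psubset_induct)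
    case (psubset L)
    consider "L = {}" | s where "L = {s}" | s t where "s \<in> L" "t \<in> L" "s \<noteq> t" by blast
    then show ?case
    proof cases
      case 3
      then obtain e where e: "e \<in> E" "s e \<noteq> t e" using psubset.prems sign_maps_eqI by blast
      then have "\<not> (s \<in> half L e v \<and> t \<in> half L e v)" for v by (auto simp: half_def)
      then have "half L e v \<subset> L" for v using 3 half_subset[of L e v] by blast
      then show ?thesis using psubset assms(5)[OF psubset.prems e(1)] by blast
    qed (use assms(3,4) psubset.prems in auto)
  qed
qed

text \<open>Pajor's form of the Sauer-Shelah lemma, obtained by adding the inequalities of the
  halves.\<close>

lemma card_le_shattered:
  assumes "finite E" "L \<subseteq> sign_maps E"
  shows "card L \<le> card (shattered_sets E L)"
  using assms
proof (induction rule: halves_induct)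
  case (singleton s)
  then have "{} \<in> shattered_sets E {s}" by (subst shattered_sets_empty) auto
  then show ?case using finite_shattered_sets[OF assms(1), of "{s}"] by (auto simp: Suc_le_eq card_gt_0_iff)
next
  case (halves L e)
  then show ?case
    using card_halves[OF assms(1) halves(1,2)] card_shattered_halves[OF assms(1) halves(1), of e]
      card_mono[OF finite_shattered_sets[OF assms(1)] shattered_halves_subset[OF halves(1,2)]]
    by linarith
qed simp

text \<open>Equality for \<open>L\<close> leaves no slack in the inequalities of the halves. It also
  leaves no shattered sets beyond those obtained from the halves, and among these only sets
  shattered by a half avoid \<open>e\<close>.\<close>

lemma ample_halves:
  assumes "finite E" "L \<subseteq> sign_maps E" "e \<in> E" "ample E L"
  shows "ample E (half L e 1)" "ample E (half L e (-1))"
    and "A \<in> shattered_sets E L \<Longrightarrow> e \<notin> A \<Longrightarrow>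
      A \<in> shattered_sets E (half L e 1) \<or> A \<in> shattered_sets E (half L e (-1))"
proof -
  let ?P = "shattered_sets E (half L e 1)" and ?N = "shattered_sets E (half L e (-1))"
  let ?S = "?P \<union> ?N \<union> insert e ` (?P \<inter> ?N)"
  have le: "card (half L e v) \<le> card (shattered_sets E (half L e v))" for v
    by (rule card_le_shattered[OF assms(1) half_sign_maps[OF assms(2)]])
  have sub: "?S \<subseteq> shattered_sets E L" by (rule shattered_halves_subset[OF assms(2,3)])
  have fin: "finite (shattered_sets E L)" using finite_shattered_sets[OF assms(1)] .
  note eqs = card_halves[OF assms(1-3)] card_shattered_halves[OF assms(1,2), of e]
    card_mono[OF fin sub] le[of 1] le[of "-1"] assms(4)[unfolded ample_iff]
  show "ample E (half L e 1)" "ample E (half L e (-1))"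
    unfolding ample_iff using eqs by linarith+
  have "card ?S = card (shattered_sets E L)" using eqs by linarith
  then have "shattered_sets E L = ?S" using card_subset_eq[OF fin sub] by simp
  then show "A \<in> ?P \<or> A \<in> ?N" if "A \<in> shattered_sets E L" "e \<notin> A"
    using that by blast
qed

lemma ample_restrict:
  assumes "finite E" "L \<subseteq> sign_maps E" "ample E L" "C \<subseteq> E" "\<forall>f\<in>C. c f = -1 \<or> c f = 1"
  shows "ample E {u \<in> L. \<forall>f\<in>C. u f = c f}"
proof -
  have "finite C" using assms(1,4) finite_subset by blast
  then show ?thesis using assms(4,5)
  proof (induction C)
    case (insert e C)
    let ?M = "{u \<in> L. \<forall>f\<in>C. u f = c f}"
    have M: "?M \<subseteq> sign_maps E" "ample E ?M" using assms(2) insert by auto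
    have e: "e \<in> E" "c e = -1 \<or> c e = 1" using insert.prems by auto
    have "ample E (half ?M e (c e))"
      using ample_halves(1,2)[OF assms(1) M(1) e(1) M(2)] e(2) by (elim disjE) simp_all
    moreover have "{u \<in> L. \<forall>f\<in>insert e C. u f = c f} = half ?M e (c e)" by (auto simp: half_def)
    ultimately show ?case by simp
  qed (simp add: assms(3))
qed

(* Fixing the coordinates outside A one by one keeps A shattered, so some fibre over A is full. *)
lemma ample_shattered_cube:
  assumes "finite E" "L \<subseteq> sign_maps E" "ample E L" "A \<in> shattered_sets E L"
  shows "\<exists>t\<in>Baryc E L. \<forall>f\<in>A. t f = 0"
proof -
  have AE: "A \<subseteq> E" using assms(4) by (simp add: shattered_sets_def)
  have fibre: "\<exists>c. (\<forall>f\<in>C. c f = -1 \<or> c f = 1) \<and> A \<in> shattered_sets E {u \<in> L. \<forall>f\<in>C. u f = c f}"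
    if "finite C" "C \<subseteq> E - A" for C
    using that
  proof (induction C)
    case (insert e C)
    then obtain c where c: "\<forall>f\<in>C. c f = -1 \<or> c f = (1::real)"
        "A \<in> shattered_sets E {u \<in> L. \<forall>f\<in>C. u f = c f}" by auto
    let ?M = "{u \<in> L. \<forall>f\<in>C. u f = c f}"
    have M: "?M \<subseteq> sign_maps E" "ample E ?M"
      using assms(2) ample_restrict[OF assms(1-3) _ c(1)] insert.prems by auto
    have "e \<in> E" "e \<notin> A" using insert.prems by auto
    then obtain v where v: "v = -1 \<or> v = 1" "A \<in> shattered_sets E (half ?M e v)"
      using ample_halves(3)[OF assms(1) M(1) _ M(2) c(2)] by blast
    have "half ?M e v = {u \<in> L. \<forall>f\<in>insert e C. u f = (c(e := v)) f}"
      using insert.hyps(2) by (auto simp: half_def)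
    then show ?case using v c(1) by (intro exI[of _ "c(e := v)"]) auto
  qed (simp add: assms(4))
  obtain c where c: "\<forall>f\<in>E - A. c f = -1 \<or> c f = 1"
      "A \<in> shattered_sets E {u \<in> L. \<forall>f\<in>E - A. u f = c f}"
    using fibre[of "E - A"] assms(1) by auto
  let ?F = "{u \<in> L. \<forall>f\<in>E - A. u f = c f}"
  \<comment> \<open>The barycenter of the full fibre: free on \<open>A\<close>, equal to
    \<open>c\<close> elsewhere.\<close>
  define t where "t = (\<lambda>f\<in>E. if f \<in> A then 0 else c f)"
  have "t \<in> sign0_maps E" unfolding t_def by (rule restrict_in_sign0_maps) (use c(1) in auto)
  moreover have "s \<in> L" if s: "s \<in> sign_maps E" "sign_le E t s" for s
  proof -
    have "restrict s A \<in> sign_maps A" using s(1) AE by (auto simp: sign_maps_def PiE_iff)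
    moreover have "?F \<subseteq> sign_maps E" using assms(2) by blast
    ultimately have "\<exists>u\<in>?F. \<forall>f\<in>A. u f = restrict s A f"
      using c(2) shattered_sets_iff[of ?F E A] by blast
    then obtain u where u: "u \<in> L" "\<forall>f\<in>E - A. u f = c f" "\<forall>f\<in>A. u f = s f" by auto
    \<comment> \<open>On \<open>A\<close> both have the pattern of \<open>s\<close>; elsewhere both
      are forced to \<open>c\<close>, \<open>u\<close> by the fibre and \<open>s\<close> by lying
      above \<open>t\<close>.\<close>
    have "u = s"
    proof (rule sign_maps_eqI[OF subsetD[OF assms(2) u(1)] s(1)])
      fix f assume f: "f \<in> E"
      show "u f = s f"
      proof (cases "f \<in> A")
        case False
        then have "c f = -1 \<or> c f = 1" using c(1) f by blast
        then have "c f \<noteq> 0" "t f = c f" using f False by (auto simp: t_def)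
        then have "s f = c f" using s(2) f unfolding sign_le_def by auto
        then show ?thesis using u(2) f False by simp
      qed (use u(3) in simp)
    qed
    then show ?thesis using u(1) by simp
  qed
  ultimately have "t \<in> Baryc E L" by (simp add: Baryc_eq)
  then show ?thesis using AE by (intro bexI[of _ t]) (auto simp: t_def)
qed

section \<open>Ampleness and 0-convexity of the barycenters\<close>

lemma Baryc_mono: "L \<subseteq> L' \<Longrightarrow> Baryc E L \<subseteq> Baryc E L'"
  by (auto simp: Baryc_eq)

lemma up_set_Baryc: "up_set E (Baryc E L)"
  unfolding up_set_def Baryc_eq by (fastforce simp: sign_le_def)

lemma sign_extension:
  assumes "t \<in> sign0_maps E" "A \<subseteq> E" "\<forall>f\<in>A. t f = 0" "s \<in> sign_maps A"
  obtains u where "u \<in> sign_maps E" "sign_le E t u" "\<forall>f\<in>A. u f = s f"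
proof
  \<comment> \<open>The 1 at the remaining zeros is an arbitrary choice of sign.\<close>
  let ?u = "\<lambda>f\<in>E. if f \<in> A then s f else if t f = 0 then 1 else t f"
  show "?u \<in> sign_maps E"
  proof (rule restrict_in_sign_maps)
    fix f assume "f \<in> E"
    then show "(if f \<in> A then s f else if t f = 0 then 1 else t f) = -1 \<or>
        (if f \<in> A then s f else if t f = 0 then 1 else t f) = 1"
      using sign0_mapsD[OF assms(1), of f] sign_mapsD[OF assms(4), of f] by auto
  qed
  show "sign_le E t ?u" "\<forall>f\<in>A. ?u f = s f" using assms(2,3) by (auto simp: sign_le_def)
qed

text \<open>In the fibre of \<open>L\<close> over the common nonzero entries, the common zeros
  together with \<open>e\<close> are shattered, since \<open>s\<close> and \<open>t\<close>
  contribute the two values at \<open>e\<close>. Ampleness yields a cube in this fibre, whose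
  barycenter is the witness.\<close>

lemma zero_convex_Baryc:
  assumes "finite E" "L \<subseteq> sign_maps E" "ample E L"
  shows "zero_convex E (Baryc E L)"
proof (rule zero_convexI)
  note up = up_set_Baryc[of E L]
  show sub: "Baryc E L \<subseteq> sign0_maps E" by (auto simp: Baryc_eq)
  fix s0 t0 e assume st0: "s0 \<in> Baryc E L" "t0 \<in> Baryc E L" "e \<in> E" "s0 e * t0 e < 0"
  define s where "s = fill E s0 t0"
  define t where "t = fill E t0 s0"
  (* s and t have the same zeros, and they agree exactly outside the coordinates of opposite sign *)
  have st: "s \<in> Baryc E L" "t \<in> Baryc E L"
    using up_set_fill[OF up] st0 sub by (auto simp: s_def t_def)
  have sm: "s \<in> sign0_maps E" "t \<in> sign0_maps E" using st sub by auto
  have e: "s e = s0 e" "t e = t0 e" using st0(3,4) by (auto simp: s_def t_def fill_def)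
  define C where "C = {f \<in> E. s f = t f \<and> s f \<noteq> 0}"
  define A where "A = insert e {f \<in> E. s f = 0}"
  let ?M = "{u \<in> L. \<forall>f\<in>C. u f = s f}"
  have C: "\<forall>f\<in>C. s f = -1 \<or> s f = 1" using sign0_mapsD[OF sm(1)] unfolding C_def by blast
  have MS: "?M \<subseteq> sign_maps E" using assms(2) by auto
  have M: "ample E ?M" by (rule ample_restrict[OF assms _ C]) (auto simp: C_def)
  have zeros: "s f = 0 \<longleftrightarrow> t f = 0" if "f \<in> E" for f using that by (auto simp: s_def t_def fill_def)
  have "A \<in> shattered_sets E ?M" unfolding shattered_sets_iff[OF MS]
  proof (intro conjI ballI)
    show "A \<subseteq> E" using st0(3) by (auto simp: A_def)
    fix a assume a: "a \<in> sign_maps A"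
    have "a e = s e \<or> a e = t e"
      using sign_mapsD[OF a, of e] sign0_mapsD[OF sm(1) st0(3)] sign0_mapsD[OF sm(2) st0(3)] st0(4) e
      by (auto simp: A_def)
    \<comment> \<open>\<open>w\<close> is \<open>s\<close> or \<open>t\<close>, whichever has the
      value required at \<open>e\<close>.\<close>
    then obtain w where w: "w \<in> Baryc E L" "w e = a e" "\<forall>f\<in>E. w f = 0 \<longleftrightarrow> s f = 0" "\<forall>f\<in>C. w f = s f"
      using st zeros by (auto simp: C_def)
    let ?Z = "{f \<in> E. s f = 0}"
    have "restrict a ?Z \<in> sign_maps ?Z"
      by (rule restrict_in_sign_maps) (use sign_mapsD[OF a] in \<open>auto simp: A_def\<close>)
    moreover have "w \<in> sign0_maps E" "?Z \<subseteq> E" "\<forall>f\<in>?Z. w f = 0" using w(1,3) sub by auto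
    ultimately obtain u where u: "u \<in> sign_maps E" "sign_le E w u" "\<forall>f\<in>?Z. u f = restrict a ?Z f"
      using sign_extension[of w E ?Z] by blast
    have "u \<in> L" using w(1) u(1,2) by (auto simp: Baryc_eq)
    moreover have uw: "u f = w f" if "f \<in> E" "s f \<noteq> 0" for f
      using u(2) w(3) that by (auto simp: sign_le_def)
    then have "\<forall>f\<in>C. u f = s f" using w(4) by (auto simp: C_def)
    moreover have "s e \<noteq> 0" using st0(4) e by auto
    then have "u e = a e" using uw[OF st0(3)] w(2) by simp
    then have "\<forall>f\<in>A. u f = a f" using u(3) by (auto simp: A_def)
    ultimately show "\<exists>u\<in>?M. \<forall>f\<in>A. u f = a f" by blast
  qed
  then obtain r where r: "r \<in> Baryc E ?M" "\<forall>f\<in>A. r f = 0"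
    using ample_shattered_cube[OF assms(1) MS M] by blast
  have r0: "r \<in> sign0_maps E" using r(1) by (simp add: Baryc_eq)
  \<comment> \<open>A vertex above \<open>r\<close> belongs to the fibre, so it shows that
    \<open>r\<close> has no wrong sign on \<open>C\<close>.\<close>
  obtain u where u: "u \<in> sign_maps E" "sign_le E r u" "\<forall>f\<in>{}. u f = (\<lambda>_\<in>{}. 1) f"
    using sign_extension[OF r0, of "{}" "\<lambda>_\<in>{}. 1"] const_in_sign_maps[of 1 "{}"] by auto
  have "u \<in> ?M" using r(1) u(1,2) by (auto simp: Baryc_eq)
  then have rC: "r f = 0 \<or> r f = s f" if "f \<in> C" for f
    using u(2) that by (auto simp: sign_le_def C_def)
  have "r f \<in> {0, s0 f, t0 f}" if f: "f \<in> E" for f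
  proof -
    consider "f \<in> A" | "f \<in> C" | "s f \<noteq> 0" "t f \<noteq> 0" "s f \<noteq> t f"
      using f zeros by (auto simp: A_def C_def)
    then show ?thesis
    proof cases
      case 1
      then show ?thesis using r(2) by simp
    next
      case 2
      then show ?thesis using rC[OF 2] f by (auto simp: s_def fill_def)
    next
      case 3
      \<comment> \<open>Here \<open>s0\<close> and \<open>t0\<close> show both signs, so every value
        is permitted.\<close>
      then have "s0 f \<noteq> 0" "t0 f \<noteq> 0" "s0 f \<noteq> t0 f" using f by (auto simp: s_def t_def fill_def split: if_splits)
      then show ?thesis
        using sign0_mapsD[OF subsetD[OF sub st0(1)] f] sign0_mapsD[OF subsetD[OF sub st0(2)] f]
          sign0_mapsD[OF r0 f] by auto
    qed
  qed
  moreover have "r \<in> Baryc E L" using r(1) Baryc_mono[of ?M L E] by blast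
  moreover have "r e = 0" using r(2) by (simp add: A_def)
  ultimately show "\<exists>r\<in>Baryc E L. r e = 0 \<and> (\<forall>f\<in>E. r f \<in> {0, s0 f, t0 f})" by blast
qed

text \<open>\<open>A\<close> is to become free while \<open>B\<close> keeps the prescribed pattern
  \<open>s\<close>. In the induction \<open>e\<close> moves from \<open>A\<close> to
  \<open>B\<close> with either sign, and 0-convexity merges the two resulting vectors at
  \<open>e\<close>.\<close>

lemma zero_convex_shattered:
  assumes "finite A" "A \<subseteq> E" and U: "up_set E U" and Z: "zero_convex E U"
    and "A \<union> B \<subseteq> E" "A \<inter> B = {}"
    and "\<And>s. s \<in> sign_maps (A \<union> B) \<Longrightarrow> \<exists>u\<in>U. \<forall>f\<in>A \<union> B. u f = s f"
    and "s \<in> sign_maps B"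
  shows "\<exists>t\<in>U. (\<forall>f\<in>A. t f = 0) \<and> (\<forall>f\<in>B. t f = s f)"
  using assms(1,2,5-)
proof (induction A arbitrary: B s)
  case empty
  then show ?case by simp
next
  case (insert e A)
  have sub: "U \<subseteq> sign0_maps E" using U by (simp add: up_set_def)
  have ext: "s(e := v) \<in> sign_maps (insert e B)" if "v = -1 \<or> v = 1" for v
    using insert.prems(5) that by (auto simp: sign_maps_def PiE_iff extensional_def)
  have AB: "A \<union> insert e B = insert e A \<union> B" by auto
  have "\<exists>t\<in>U. (\<forall>f\<in>A. t f = 0) \<and> (\<forall>f\<in>insert e B. t f = (s(e := v)) f)" if "v = -1 \<or> v = 1" for v
  proof (rule insert.IH)
    show "\<exists>u\<in>U. \<forall>f\<in>A \<union> insert e B. u f = a f" if "a \<in> sign_maps (A \<union> insert e B)" for a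
      using insert.prems(4)[of a] that unfolding AB by blast
    show "A \<subseteq> E" "A \<union> insert e B \<subseteq> E" "A \<inter> insert e B = {}"
      using insert.prems(1-3) insert.hyps by auto
    show "s(e := v) \<in> sign_maps (insert e B)" using ext[OF that] .
  qed
  from this[of "-1"] this[of 1] obtain p q where
    p: "p \<in> U" "\<forall>f\<in>A. p f = 0" "p e = -1" "\<forall>f\<in>B. p f = s f" and
    q: "q \<in> U" "\<forall>f\<in>A. q f = 0" "q e = 1" "\<forall>f\<in>B. q f = s f"
    using insert.prems(3) by auto
  obtain r where r: "r \<in> U" "r e = 0" "\<forall>f\<in>E. r f \<in> {0, p f, q f}"
    using zero_convexD[OF Z sub p(1) q(1), of e] p(3) q(3) insert.prems(1) by auto
  \<comment> \<open>The merged vector may have lost entries on \<open>B\<close>; filling with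
    \<open>b\<close> restores them and leaves the zeros on \<open>A\<close> alone.\<close>
  define b where "b = (\<lambda>f\<in>E. if f \<in> B then s f else 0)"
  have "b \<in> sign0_maps E" unfolding b_def
    by (rule restrict_in_sign0_maps) (use sign_mapsD[OF insert.prems(5)] in auto)
  then have "fill E r b \<in> U" using up_set_fill[OF U r(1)] by blast
  moreover have "\<forall>f\<in>insert e A. fill E r b f = 0"
    using r(2,3) p(2) q(2) insert.prems(1,3) by (auto simp: fill_def b_def)
  moreover have "\<forall>f\<in>B. fill E r b f = s f"
    using r(3) p(4) q(4) insert.prems(2) by (auto simp: fill_def b_def)
  ultimately show ?case by blast
qed

text \<open>\<open>U\<close> varies in the induction because the halves of \<open>L\<close> come
  from the halves of \<open>U\<close>. What remains is that every set shattered by \<open>L\<close>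
  arises from the halves; then the counts add up.\<close>

lemma ample_if_zero_convex:
  assumes "finite E" "L \<subseteq> sign_maps E" "up_set E U" "zero_convex E U" "L = U \<inter> sign_maps E"
  shows "ample E L"
  using assms
proof (induction L arbitrary: U rule: halves_induct)
  case empty
  have "shattered_sets E {} = {}"
    by (auto simp: shattered_sets_iff) (use const_in_sign_maps[of 1] in blast)
  then show ?case by (simp add: ample_iff)
next
  case (singleton s)
  have "A = {}" if "A \<in> shattered_sets E {s}" for A
  proof (rule ccontr)
    assume "A \<noteq> {}"
    then obtain e where e: "e \<in> A" by blast
    have *: "\<forall>a\<in>sign_maps A. \<forall>f\<in>A. s f = a f"
      using that singleton(1) by (subst (asm) shattered_sets_iff) auto
    show False
      using *[rule_format, OF const_in_sign_maps[of 1 A] e]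
        *[rule_format, OF const_in_sign_maps[of "-1" A] e] e by simp
  qed
  moreover have "{} \<in> shattered_sets E {s}" using singleton(1) by (subst shattered_sets_empty) auto
  ultimately have "shattered_sets E {s} = {{}}" by blast
  then show ?case by (simp add: ample_iff)
next
  case (halves L e U)
  note L = halves(1) and e = halves(2) and U = halves(5) and Z = halves(6) and LU = halves(7)
  have sub: "U \<subseteq> sign0_maps E" using U by (simp add: up_set_def)
  have half: "up_set E (half U e v)" "zero_convex E (half U e v)"
    "half L e v = half U e v \<inter> sign_maps E" if v: "v = -1 \<or> v = 1" for v
  proof -
    show "up_set E (half U e v)"
      unfolding up_set_def
    proof (intro conjI ballI impI)
      show "half U e v \<subseteq> sign0_maps E" using sub by (auto simp: half_def)
      fix t t' assume t: "t \<in> half U e v" "t' \<in> sign0_maps E" "sign_le E t t'"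
      then have "t' \<in> U" using up_setD[OF U] by (auto simp: half_def)
      moreover have "t e \<in> {0, t' e}" "t e = v" using t e by (auto simp: half_def sign_le_def)
      then have "t' e = v" using v by auto
      ultimately show "t' \<in> half U e v" by (simp add: half_def)
    qed
    show "half L e v = half U e v \<inter> sign_maps E" using LU by (auto simp: half_def)
    show "zero_convex E (half U e v)"
    proof (rule zero_convexI)
      show "half U e v \<subseteq> sign0_maps E" using sub half_subset[of U e v] by blast
      fix s t f assume st: "s \<in> half U e v" "t \<in> half U e v" "f \<in> E" "s f * t f < 0"
      then have U': "s \<in> U" "t \<in> U" "s e = v" "t e = v" by (auto simp: half_def)
      obtain r where r: "r \<in> U" "r f = 0" "\<forall>g\<in>E. r g \<in> {0, s g, t g}"
        using zero_convexD[OF Z sub U'(1,2) st(3,4)] by blast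
      have fe: "f \<noteq> e" using st(4) U'(3,4) v by auto
      have "r e = 0 \<or> r e = v" using r(3) e U'(3,4) by auto
      \<comment> \<open>The witness may vanish at \<open>e\<close> and so leave the half; going up
        restores \<open>v\<close>.\<close>
      then have "r(e := v) \<in> U"
      proof
        assume "r e = 0"
        then show ?thesis using up_set_fun_upd[OF U r(1) e, of v] v by blast
      next
        assume "r e = v"
        then show ?thesis using r(1) fun_upd_triv[of r e] by simp
      qed
      then have "r(e := v) \<in> half U e v" by (simp add: half_def)
      then show "\<exists>r\<in>half U e v. r f = 0 \<and> (\<forall>g\<in>E. r g \<in> {0, s g, t g})"
        using r(2,3) fe U'(3) by (intro bexI[of _ "r(e := v)"]) auto
    qed
  qed
  have IH: "ample E (half L e 1)" "ample E (half L e (-1))"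
    using halves(3)[OF half(1-3)] halves(4)[OF half(1-3)] by auto
  let ?P = "shattered_sets E (half L e 1)" and ?N = "shattered_sets E (half L e (-1))"
  have hs: "half L e v \<subseteq> sign_maps E" for v using half_sign_maps[OF L] .
  have "shattered_sets E L \<subseteq> ?P \<union> ?N \<union> insert e ` (?P \<inter> ?N)"
  proof
    fix A assume A: "A \<in> shattered_sets E L"
    then have AE: "A \<subseteq> E" and As: "\<And>s. s \<in> sign_maps A \<Longrightarrow> \<exists>u\<in>L. \<forall>f\<in>A. u f = s f"
      using shattered_sets_iff[OF L] by auto
    show "A \<in> ?P \<union> ?N \<union> insert e ` (?P \<inter> ?N)"
    proof (cases "e \<in> A")
      case True
      have "A - {e} \<in> shattered_sets E (half L e v)" if v: "v = -1 \<or> v = 1" for v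
        unfolding shattered_sets_iff[OF hs]
      proof (intro conjI ballI)
        show "A - {e} \<subseteq> E" using AE by auto
        fix s assume "s \<in> sign_maps (A - {e})"
        then have "s(e := v) \<in> sign_maps A"
          using v True by (auto simp: sign_maps_def PiE_iff extensional_def)
        then obtain u where "u \<in> L" "\<forall>f\<in>A. u f = (s(e := v)) f" using As by blast
        then show "\<exists>u\<in>half L e v. \<forall>f\<in>A - {e}. u f = s f"
          using True by (intro bexI[of _ u]) (auto simp: half_def)
      qed
      then have "A - {e} \<in> ?P \<inter> ?N" by auto
      then show ?thesis using True by (metis UnI2 image_eqI insert_Diff)
    next
      case False
      have "finite A" using AE assms(1) finite_subset by blast
      \<comment> \<open>With nothing prescribed, all of \<open>A\<close> becomes free in one member
        of \<open>U\<close>; \<open>\<lambda>_. undefined\<close> is the only map on the empty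
        set.\<close>
      then have "\<exists>t\<in>U. (\<forall>f\<in>A. t f = 0) \<and> (\<forall>f\<in>{}. t f = undefined)"
      proof (rule zero_convex_shattered[OF _ AE U Z])
        show "A \<union> {} \<subseteq> E" "A \<inter> {} = {}" using AE by auto
        show "\<exists>u\<in>U. \<forall>f\<in>A \<union> {}. u f = s f" if "s \<in> sign_maps (A \<union> {})" for s
          using As[of s] that LU by auto
        show "(\<lambda>_. undefined) \<in> sign_maps {}" by (simp add: sign_maps_def)
      qed
      then obtain t where t: "t \<in> U" "\<forall>f\<in>A. t f = 0" by blast
      have t0: "t \<in> sign0_maps E" using t(1) sub by blast
      \<comment> \<open>If \<open>t\<close> is free at \<open>e\<close>, either half would do, and 1
        is picked.\<close>
      define v where "v = (if t e = 0 then 1 else t e)"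
      have v: "v = -1 \<or> v = 1" using sign0_mapsD[OF t0 e] unfolding v_def by (cases "t e = 0") auto
      have "A \<in> shattered_sets E (half L e v)" unfolding shattered_sets_iff[OF hs]
      proof (intro conjI ballI AE)
        fix s assume s: "s \<in> sign_maps A"
        have "t(e := v) \<in> U"
        proof (cases "t e = 0")
          case True
          then show ?thesis using up_set_fun_upd[OF U t(1) e True, of v] v by blast
        qed (simp add: v_def t(1))
        moreover have "\<forall>f\<in>A. (t(e := v)) f = 0" using t(2) False by auto
        ultimately obtain u where u: "u \<in> sign_maps E" "sign_le E (t(e := v)) u" "\<forall>f\<in>A. u f = s f"
          using sign_extension[OF _ AE _ s] sub by blast
        then have "u \<in> U" using up_setD[OF U \<open>t(e := v) \<in> U\<close>] u(1,2) sign_maps_subset[of E] by blast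
        moreover have "u e = v" using u(2) e v by (auto simp: sign_le_def)
        ultimately show "\<exists>u\<in>half L e v. \<forall>f\<in>A. u f = s f"
          using u LU by (intro bexI[of _ u]) (auto simp: half_def)
      qed
      then show ?thesis using v by auto
    qed
  qed
  then have "shattered_sets E L = ?P \<union> ?N \<union> insert e ` (?P \<inter> ?N)"
    using shattered_halves_subset[OF L e] by blast
  then show ?case
    using IH card_halves[OF assms(1) L e] card_shattered_halves[OF assms(1) L, of e]
    unfolding ample_iff by simp
qed

section \<open>Assembly of the six equivalent conditions\<close>

theorem theorem2:
  fixes E :: "'a set" and J L :: "('a \<Rightarrow> real) set"
  assumes "finite E"
    and "J \<subseteq> sign0_maps E"
    and "L = up_closure E J \<inter> sign_maps E"
  shows "(weakly_convex E (face_union E J) \<longleftrightarrow> sign_convex E (up_closure E J)) \<and>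
    (sign_convex E (up_closure E J) \<longleftrightarrow> zero_convex E (up_closure E J)) \<and>
    (zero_convex E (up_closure E J) \<longleftrightarrow> zero_convex E J) \<and>
    (zero_convex E J \<longleftrightarrow> grid_isometric E (up_closure E J)) \<and>
    (grid_isometric E (up_closure E J) \<longleftrightarrow>
      (ample E L \<and> face_union E J = cube_complex E L \<and> up_closure E J = Baryc E L))"
proof -
  let ?U = "up_closure E J"
  note U = up_set_up_closure[of E J]
  have sub: "?U \<subseteq> sign0_maps E" using U by (simp add: up_set_def)
  have FU: "face_union E J = face_union E ?U" using face_union_up_closure[OF assms(2)] by simp
  have LS: "L \<subseteq> sign_maps E" using assms(3) by blast
  have SZ: "sign_convex E ?U \<longleftrightarrow> zero_convex E ?U" by (rule sign_convex_iff_zero_convex[OF U])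
  have MZ: "zero_convex E ?U" if "grid_menger E ?U"
    using zero_convex_if_isometric[OF assms(1) sub] grid_isometric_if_menger[OF assms(1) sub that] .
  \<comment> \<open>The circle runs from sign-convexity to weak convexity, on to intermediate grid
    points, to 0-convexity and back.\<close>
  have W: "weakly_convex E (face_union E J) \<longleftrightarrow> sign_convex E ?U"
    unfolding FU using weakly_convex_if_sign_convex[OF assms(1) U]
      grid_menger_if_weakly_convex[OF assms(1) U] MZ SZ by blast
  have G: "zero_convex E ?U \<longleftrightarrow> grid_isometric E ?U"
    using zero_convex_if_isometric[OF assms(1) sub] grid_isometric_if_menger[OF assms(1) sub]
      grid_menger_if_sign_convex[OF assms(1) U] SZ by blast
  \<comment> \<open>One inclusion holds for every up-set; 0-convexity supplies the other.\<close>
  have B: "?U = Baryc E L" if "zero_convex E ?U"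
    using Baryc_subset_zero_convex[OF assms(1) U that] up_set_subset_Baryc[OF U] assms(3) by blast
  have "zero_convex E ?U \<longleftrightarrow>
    ample E L \<and> face_union E J = cube_complex E L \<and> ?U = Baryc E L"
  proof
    assume Z: "zero_convex E ?U"
    have "face_union E J = cube_complex E L" using B[OF Z] by (simp add: FU cube_complex_eq)
    then show "ample E L \<and> face_union E J = cube_complex E L \<and> ?U = Baryc E L"
      using B[OF Z] ample_if_zero_convex[OF assms(1) LS U Z assms(3)] by blast
  next
    assume "ample E L \<and> face_union E J = cube_complex E L \<and> ?U = Baryc E L"
    then show "zero_convex E ?U" using zero_convex_Baryc[OF assms(1) LS] by simp
  qed
  then show ?thesis using W SZ G zero_convex_up_closure_iff[OF assms(2)] by blast
qed

end
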